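(* Let $d \geq 2$ be an integer and let $p$ be an odd prime with $p\equiv \pm1 \pmod d$. Then \[ {}_{2}G\left( \tfrac{1}{d}, 1-\tfrac{1}{d} \right)_p \equiv {}_{2}F_1\left[ \begin{array}{cc} \frac{1}{d}, & 1-\frac{1}{d}\\ & 1 \end{array} \Big| \; 1 \right]_{p-1} \pmod {p^2}. \]
   Context: $\Gamma_p$ is Morita's $p$-adic gamma function. For real $x$, $\lfloor x\rfloor$ is the floor and $\langle x\rangle:=x-\lfloor x\rfloor$. For an odd prime $p$, $n\in\mathbb{Z}^+$ and $\frac{m_i}{d_i}\in\mathbb{Q}\cap\mathbb{Z}_p$ with $0<\frac{m_i}{d_i}<1$, define ${}_{n+1}G\left(\tfrac{m_1}{d_1},\dots,\tfrac{m_{n+1}}{d_{n+1}}\right)_p:=\frac{-1}{p-1}\sum_{j=0}^{p-2}\left((-1)^j\Gamma_p(\tfrac{j}{p-1})\right)^{n+1}\prod_{i=1}^{n+1}\frac{\Gamma_p(\langle \frac{m_i}{d_i}-\frac{j}{p-1}\rangle)}{\Gamma_p(\frac{m_i}{d_i})}(-p)^{-\lfloor \frac{m_i}{d_i}-\frac{j}{p-1}\rfloor}$. Rising factorial: $(a)_0:=1$, $(a)_k:=a(a+1)\cdots(a+k-1)$. Truncated hypergeometric series: ${}_rF_s\left[\begin{array}{ccc}a_1,&\dots,&a_r\\ &b_1,\dots,&b_s\end{array}\Big|\,z\right]_m:=\sum_{k=0}^{m}\frac{(a_1)_k\cdots(a_r)_k}{(b_1)_k\cdots(b_s)_k}\frac{z^k}{k!}$.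 Congruences are in $\mathbb{Z}_p$. *)

theory Defs
  imports
    "HOL-Number_Theory.Number_Theory"
    "HOL-Computational_Algebra.Computational_Algebra"
    "Berlekamp_Zassenhaus.Finite_Field"
begin

section \<open>The ring of \<open>p\<close>-adic integers\<close>

text \<open>
  The prime \<open>p\<close> is carried by a type variable, \<open>p = CARD('p)\<close>. A \<open>p\<close>-adic integer is an element
  of the inverse limit of the rings \<open>\<int>/p\<^sup>n\<int>\<close>, each residue class being represented by its member
  in \<open>{0..<p\<^sup>n}\<close>.
\<close>

typedef (overloaded) 'p :: prime_card padic_int =
  "{x :: nat \<Rightarrow> int. \<forall>n. x n \<in> {0..<int CARD('p) ^ n} \<and> x (Suc n) mod int CARD('p) ^ n = x n}"
  by (rule exI[of _ "\<lambda>_. 0"]) simp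

setup_lifting type_definition_padic_int

lemma padic_mod_mod: "(a :: int) mod P ^ Suc n mod P ^ n = a mod P ^ n"
  by (rule mod_mod_cancel) simp

lemma padic_card_gt_1: "int CARD('p :: prime_card) > 1"
  using prime_gt_1_nat[OF prime_card[where ?'a = 'p]] by simp

lemma padic_card_pos: "int CARD('p :: prime_card) ^ n > 0"
  using padic_card_gt_1[where ?'p = 'p] by simp

instantiation padic_int :: (prime_card) comm_ring_1
begin

lift_definition zero_padic_int :: "'a padic_int" is "\<lambda>_. 0"
  by simp

lift_definition one_padic_int :: "'a padic_int" is "\<lambda>n. 1 mod int CARD('a) ^ n"
  using padic_card_pos[where ?'p = 'a] by (simp add: padic_mod_mod del: power_Suc)

lift_definition plus_padic_int :: "'a padic_int \<Rightarrow> 'a padic_int \<Rightarrow> 'a padic_int"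
  is "\<lambda>x y n. (x n + y n) mod int CARD('a) ^ n"
  using padic_card_pos[where ?'p = 'a]
  by (simp add: padic_mod_mod del: power_Suc) (metis mod_add_eq)

lift_definition minus_padic_int :: "'a padic_int \<Rightarrow> 'a padic_int \<Rightarrow> 'a padic_int"
  is "\<lambda>x y n. (x n - y n) mod int CARD('a) ^ n"
  using padic_card_pos[where ?'p = 'a]
  by (simp add: padic_mod_mod del: power_Suc) (metis mod_diff_eq)

lift_definition uminus_padic_int :: "'a padic_int \<Rightarrow> 'a padic_int"
  is "\<lambda>x n. (- x n) mod int CARD('a) ^ n"
  using padic_card_pos[where ?'p = 'a]
  by (simp add: padic_mod_mod del: power_Suc) (metis mod_minus_eq)

lift_definition times_padic_int :: "'a padic_int \<Rightarrow> 'a padic_int \<Rightarrow> 'a padic_int"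
  is "\<lambda>x y n. (x n * y n) mod int CARD('a) ^ n"
  using padic_card_pos[where ?'p = 'a]
  by (simp add: padic_mod_mod del: power_Suc) (metis mod_mult_eq)

instance
proof
  fix a b c :: "'a padic_int"
  show "a + b + c = a + (b + c)"
    by transfer (simp add: mod_simps algebra_simps)
  show "a + b = b + a"
    by transfer (simp add: add.commute)
  show "0 + a = a"
    by transfer auto
  show "- a + a = 0"
    by transfer (simp add: mod_simps)
  show "a - b = a + - b"
    by transfer (simp add: mod_simps)
  show "a * b * c = a * (b * c)"
    by transfer (simp add: mod_simps algebra_simps)
  show "a * b = b * a"
    by transfer (simp add: mult.commute)
  show "1 * a = a"
    by transfer (auto simp: mod_simps)
  show "(a + b) * c = a * c + b * c"
    by transfer (simp add: mod_simps algebra_simps)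
  show "(0 :: 'a padic_int) \<noteq> 1"
  proof transfer
    show "(\<lambda>_. 0) \<noteq> (\<lambda>n. 1 mod int CARD('a) ^ n)"
      using padic_card_gt_1[where ?'p = 'a] by (auto simp: fun_eq_iff intro!: exI[of _ 1])
  qed
qed

end

lemma Rep_padic_int_bounds:
  fixes x :: "'p :: prime_card padic_int"
  shows "Rep_padic_int x n \<ge> 0" "Rep_padic_int x n < int CARD('p) ^ n"
  using Rep_padic_int[of x] by auto

lemma Rep_padic_int_mod:
  fixes x :: "'p :: prime_card padic_int"
  assumes "m \<le> n"
  shows "Rep_padic_int x n mod int CARD('p) ^ m = Rep_padic_int x m"
  using assms
proof (induction n rule: dec_induct)
  case base
  show ?case using Rep_padic_int_bounds[of x m] by simp
next
  case (step n)
  have "int CARD('p) ^ m dvd int CARD('p) ^ n"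
    using step.hyps by (simp add: le_imp_power_dvd)
  then have "Rep_padic_int x (Suc n) mod int CARD('p) ^ m =
      Rep_padic_int x (Suc n) mod int CARD('p) ^ n mod int CARD('p) ^ m"
    by (simp add: mod_mod_cancel)
  also have "Rep_padic_int x (Suc n) mod int CARD('p) ^ n = Rep_padic_int x n"
    using Rep_padic_int[of x] by auto
  finally show ?case using step.IH by simp
qed

lemma Rep_padic_int_of_nat:
  "Rep_padic_int (of_nat k :: 'p :: prime_card padic_int) n = int k mod int CARD('p) ^ n"
  by (induction k)
    (simp_all add: zero_padic_int.rep_eq plus_padic_int.rep_eq one_padic_int.rep_eq mod_simps)

instance padic_int :: (prime_card) idom
proof
  fix a b :: "'a padic_int"
  let ?p = "int CARD('a)"
  assume "a \<noteq> 0" "b \<noteq> 0"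
  then obtain m n where m: "Rep_padic_int a m \<noteq> 0" and n: "Rep_padic_int b n \<noteq> 0"
    by (auto simp: Rep_padic_int_inject[symmetric] zero_padic_int.rep_eq fun_eq_iff)
  define A B where "A = Rep_padic_int a (m + n)" and "B = Rep_padic_int b (m + n)"
  have A: "\<not> ?p ^ m dvd A"
    using m Rep_padic_int_mod[of m "m + n" a] by (simp add: A_def dvd_eq_mod_eq_0)
  have B: "\<not> ?p ^ n dvd B"
    using n Rep_padic_int_mod[of n "m + n" b] by (simp add: B_def dvd_eq_mod_eq_0)
  have p: "prime ?p"
    by (rule prime_card_int)
  have AB0: "A \<noteq> 0" "B \<noteq> 0"
    using A B by auto
  have "multiplicity ?p A < m" "multiplicity ?p B < n"
    using A B by (meson multiplicity_dvd' not_le_imp_less)+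
  moreover have "multiplicity ?p (A * B) = multiplicity ?p A + multiplicity ?p B"
    using p AB0 by (intro prime_elem_multiplicity_mult_distrib) auto
  ultimately have "multiplicity ?p (A * B) < m + n"
    by simp
  moreover have "\<not> is_unit ?p"
    using p not_prime_unit by blast
  ultimately have "\<not> ?p ^ (m + n) dvd A * B"
    using AB0 by (simp add: power_dvd_iff_le_multiplicity)
  then have "Rep_padic_int (a * b) (m + n) \<noteq> 0"
    by (simp add: times_padic_int.rep_eq A_def B_def dvd_eq_mod_eq_0)
  then show "a * b \<noteq> 0"
    by (auto simp: zero_padic_int.rep_eq)
qed

instance padic_int :: (prime_card) ring_char_0
proof
  show "inj (of_nat :: nat \<Rightarrow> 'a padic_int)"
  proof (rule injI)
    fix k l :: nat
    assume eq: "(of_nat k :: 'a padic_int) = of_nat l"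
    have "int (k + l) < int CARD('a) ^ (k + l)"
    proof -
      have "CARD('a) > 1"
        by (rule prime_gt_1_nat[OF prime_card])
      then have "k + l < CARD('a) ^ (k + l)"
        by (simp add: power_gt_expt)
      then show ?thesis
        by (simp only: of_nat_power[symmetric] of_nat_less_iff)
    qed
    then have "int k < int CARD('a) ^ (k + l)" "int l < int CARD('a) ^ (k + l)"
      by linarith+
    with eq show "k = l"
      by (metis Rep_padic_int_of_nat mod_pos_pos_trivial of_nat_0_le_iff of_nat_eq_iff)
  qed
qed

text \<open>The \<open>p\<close>-adic topology: the cosets \<open>x + p\<^sup>n\<int>\<^sub>p\<close> form a neighbourhood basis at \<open>x\<close>.\<close>

instantiation padic_int :: (prime_card) t2_space
begin

definition open_padic_int :: "'a padic_int set \<Rightarrow> bool" where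
  "open_padic_int U \<longleftrightarrow> (\<forall>x\<in>U. \<exists>n. \<forall>y. of_nat CARD('a) ^ n dvd y - x \<longrightarrow> y \<in> U)"

instance
proof
  show "open (UNIV :: 'a padic_int set)"
    by (simp add: open_padic_int_def)
next
  fix S T :: "'a padic_int set"
  assume S: "open S" and T: "open T"
  show "open (S \<inter> T)"
    unfolding open_padic_int_def
  proof
    fix x assume "x \<in> S \<inter> T"
    then obtain m n where
      "\<And>y. of_nat CARD('a) ^ m dvd y - x \<Longrightarrow> y \<in> S"
      "\<And>y. of_nat CARD('a) ^ n dvd y - x \<Longrightarrow> y \<in> T"
      using S T unfolding open_padic_int_def by (metis IntE)
    then show "\<exists>n. \<forall>y. of_nat CARD('a) ^ n dvd y - x \<longrightarrow> y \<in> S \<inter> T"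
      by (intro exI[of _ "m + n"]) (auto simp: power_add dest: dvd_mult_left dvd_mult_right)
  qed
next
  fix K :: "'a padic_int set set"
  assume "\<forall>S\<in>K. open S"
  then show "open (\<Union> K)"
    unfolding open_padic_int_def by (meson UnionE UnionI)
next
  fix x y :: "'a padic_int"
  assume "x \<noteq> y"
  then obtain n where "Rep_padic_int (x - y) n \<noteq> 0"
    by (metis Rep_padic_int_inject eq_iff_diff_eq_0 ext zero_padic_int.rep_eq)
  moreover have "Rep_padic_int z n = 0" if dvd: "of_nat CARD('a) ^ n dvd z" for z :: "'a padic_int"
  proof -
    obtain w where "z = of_nat (CARD('a) ^ n) * w"
      using dvd by auto
    then show ?thesis
      by (simp add: times_padic_int.rep_eq Rep_padic_int_of_nat del: of_nat_power)
        (simp add: mod_simps)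
  qed
  ultimately have n: "\<not> of_nat CARD('a) ^ n dvd x - y"
    by blast
  define B where "B = (\<lambda>u :: 'a padic_int. {z. of_nat CARD('a) ^ n dvd z - u})"
  have "open (B u)" for u
    unfolding open_padic_int_def B_def
  proof (intro ballI exI[of _ n] allI impI)
    fix v w :: "'a padic_int"
    assume "v \<in> {z. of_nat CARD('a) ^ n dvd z - u}" "of_nat CARD('a) ^ n dvd w - v"
    then have "of_nat CARD('a) ^ n dvd (w - v) + (v - u)"
      by (intro dvd_add) auto
    then show "w \<in> {z. of_nat CARD('a) ^ n dvd z - u}"
      by simp
  qed
  moreover have "x \<in> B x" "y \<in> B y"
    by (simp_all add: B_def)
  moreover have "B x \<inter> B y = {}"
  proof (rule ccontr)
    assume "B x \<inter> B y \<noteq> {}"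
    then obtain z where "of_nat CARD('a) ^ n dvd z - x" "of_nat CARD('a) ^ n dvd z - y"
      by (auto simp: B_def)
    then have "of_nat CARD('a) ^ n dvd (z - y) - (z - x)"
      by (rule dvd_diff[rotated])
    with n show False
      by simp
  qed
  ultimately show "\<exists>U V. open U \<and> open V \<and> x \<in> U \<and> y \<in> V \<and> U \<inter> V = {}"
    by blast
qed

end


section \<open>The field of \<open>p\<close>-adic numbers\<close>

type_synonym 'p padic = "'p padic_int fract"

instance fract :: ("{idom, ring_char_0}") field_char_0
proof
  show "inj (of_nat :: nat \<Rightarrow> 'a fract)"
    by (rule injI) (simp add: of_nat_fract eq_fract)
qed

definition padic_integers :: "'p :: prime_card padic set" (\<open>\<int>\<^sub>p\<close>) where
  "\<int>\<^sub>p = range to_fract"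

text \<open>\<open>x \<equiv> y (mod m)\<close> in \<open>\<int>\<^sub>p\<close>; in particular both sides are \<open>p\<close>-adic integers.\<close>

definition padic_cong :: "'p :: prime_card padic \<Rightarrow> 'p padic \<Rightarrow> nat \<Rightarrow> bool" where
  "padic_cong x y m \<longleftrightarrow> x \<in> \<int>\<^sub>p \<and> y \<in> \<int>\<^sub>p \<and> (\<exists>z\<in>\<int>\<^sub>p. x - y = of_nat m * z)"

text \<open>The inclusion of \<open>\<rat> \<inter> \<int>\<^sub>p\<close> in \<open>\<int>\<^sub>p\<close>; the value is unspecified if \<open>p\<close> divides the denominator.\<close>

definition padic_int_of_rat :: "rat \<Rightarrow> 'p :: prime_card padic_int" where
  "padic_int_of_rat q = (THE z. to_fract z = of_rat q)"


section \<open>Morita's \<open>p\<close>-adic gamma function\<close>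

definition padic_gamma_nat :: "nat \<Rightarrow> 'p :: prime_card padic_int" where
  "padic_gamma_nat n = (- 1) ^ n * (\<Prod>j | 0 < j \<and> j < n \<and> \<not> CARD('p) dvd j. of_nat j)"

text \<open>\<open>\<Gamma>\<^sub>p(x)\<close> is the limit of \<open>\<Gamma>\<^sub>p(n)\<close> as the positive integer \<open>n\<close> tends \<open>p\<close>-adically to \<open>x\<close>.\<close>

definition padic_gamma :: "'p :: prime_card padic_int \<Rightarrow> 'p padic_int" where
  "padic_gamma x = Lim (inf (filtercomap of_nat (nhds x)) (principal {0<..})) padic_gamma_nat"

definition padic_gamma_rat :: "rat \<Rightarrow> 'p :: prime_card padic" where
  "padic_gamma_rat q = to_fract (padic_gamma (padic_int_of_rat q))"


section \<open>Hypergeometric functions\<close>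

text \<open>
  The function \<open>\<^sub>n\<^sub>+\<^sub>1G\<close>, the list \<open>as\<close> consisting of the \<open>n + 1\<close> arguments \<open>m\<^sub>i/d\<^sub>i\<close>.
\<close>

definition padic_G :: "rat list \<Rightarrow> 'p :: prime_card padic" where
  "padic_G as =
    (let p = CARD('p) in
      (- 1) / (of_nat p - 1) *
      (\<Sum>j = 0..p - 2.
        ((- 1) ^ j * padic_gamma_rat (of_nat j / (of_nat p - 1))) ^ length as *
        (\<Prod>a\<leftarrow>as.
          padic_gamma_rat (frac (a - of_nat j / (of_nat p - 1))) / padic_gamma_rat a *
          (- of_nat p) powi (- \<lfloor>a - of_nat j / (of_nat p - 1)\<rfloor>))))"

definition truncated_hypergeometric ::
    "'a :: field_char_0 list \<Rightarrow> 'a list \<Rightarrow> 'a \<Rightarrow> nat \<Rightarrow> 'a" where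
  "truncated_hypergeometric as bs z m =
    (\<Sum>k = 0..m. (\<Prod>a\<leftarrow>as. pochhammer a k) / (\<Prod>b\<leftarrow>bs. pochhammer b k) * (z ^ k / fact k))"

end

theory Submission
  imports Defs
begin

text \<open>
  Let \<open>r = \<lfloor>(p - 1)/d\<rfloor>\<close> and let \<open>b\<close> be the one of \<open>1/d\<close>, \<open>1 - 1/d\<close> that is congruent to \<open>-r\<close> modulo \<open>p\<close>; then
  \<open>b = -r + p/d\<close> exactly. Likewise \<open>j/(p - 1) = -j + p j/(p - 1)\<close>, so every value of \<open>\<Gamma>\<^sub>p\<close> that occurs
  is taken at an integer plus a multiple of \<open>p\<close>, where \<open>\<Gamma>\<^sub>p\<close> is known modulo \<open>p\<^sup>2\<close> from factorials and
  harmonic numbers \<open>H\<^sub>n\<close>. The \<open>j\<close>-th terms of both sides have the same \<open>p\<close>-adic order: \<open>0\<close> for \<open>j \<le> r\<close>,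
  at least \<open>1\<close> for \<open>r < j < p - r\<close>, and at least \<open>2\<close> for \<open>j \<ge> p - r\<close>. Comparing them term by term, the
  difference of the two sides is \<open>p S\<close> modulo \<open>p\<^sup>2\<close> with
  \<open>S = (\<Sum>j\<le>r. w\<^sub>j (1 + j (H\<^bsub>r-j\<^esub> + H\<^bsub>r+j\<^esub> - 2 H\<^sub>j))) + (-1)\<^sup>r (\<Sum>r<j<p-r. R j)\<close>, where
  \<open>w\<^sub>j = (-1)\<^sup>j (r choose j) ((r + j) choose j)\<close> and \<open>R x = (\<Prod>i=1..r. (x + i)/(x - i))\<close>.
  The residue of \<open>R\<close> at \<open>i\<close> is \<open>(-1)\<^sup>r i w\<^sub>i\<close>. Its partial fraction expansion, evaluated at \<open>0\<close>, at
  \<open>-1, ..., -r\<close> (the zeros of \<open>R\<close>) and summed over \<open>r < j < p\<close>, gives \<open>S \<equiv> 0\<close> modulo \<open>p\<close>.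
\<close>

section \<open>The ring of p-adic integers and the gamma function at natural numbers\<close>

text \<open>Links divisibility by \<open>p^n\<close>, in which all later approximations are phrased,
  to the residue sequence. For the direction that needs a quotient, its residues are read off: the
  \<open>m\<close>-th one is the \<open>(n + m)\<close>-th residue of \<open>x\<close> divided by
  \<open>p^n\<close>.\<close>

lemma padic_dvd_iff:
  fixes x :: "'p :: prime_card padic_int"
  shows "of_nat CARD('p) ^ n dvd x \<longleftrightarrow> Rep_padic_int x n = 0"
proof
  assume "of_nat CARD('p) ^ n dvd x"
  then obtain w where "x = of_nat (CARD('p) ^ n) * w"
    by auto
  then show "Rep_padic_int x n = 0"
    by (simp add: times_padic_int.rep_eq Rep_padic_int_of_nat del: of_nat_power)
      (simp add: mod_simps)
next
  let ?P = "int CARD('p)"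
  assume x0: "Rep_padic_int x n = 0"
  define f where "f = (\<lambda>m. Rep_padic_int x (n + m) div ?P ^ n)"
  have dv: "?P ^ n dvd Rep_padic_int x (n + m)" for m
    using Rep_padic_int_mod[of n "n + m" x] x0 by (simp add: dvd_eq_mod_eq_0)
  have f: "f \<in> {x. \<forall>n. x n \<in> {0..<?P ^ n} \<and> x (Suc n) mod ?P ^ n = x n}"
  proof (clarify, intro conjI)
    fix m
    have "f m \<ge> 0"
      unfolding f_def using Rep_padic_int_bounds(1)[of x "n + m"] padic_card_pos[where ?'p = 'p]
      by (simp add: pos_imp_zdiv_nonneg_iff)
    moreover have "?P ^ n * f m < ?P ^ n * ?P ^ m"
      unfolding f_def using Rep_padic_int_bounds(2)[of x "n + m"] dv[of m] by (simp add: power_add)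
    ultimately show "f m \<in> {0..<?P ^ m}"
      using padic_card_pos[where ?'p = 'p, of n] by simp
    have "Rep_padic_int x (n + m) = Rep_padic_int x (n + Suc m) mod (?P ^ n * ?P ^ m)"
      using Rep_padic_int_mod[of "n + m" "n + Suc m" x] by (simp add: power_add)
    also have "\<dots> = ?P ^ n * (Rep_padic_int x (n + Suc m) div ?P ^ n mod ?P ^ m)"
      using dv[of "Suc m"] padic_card_pos[where ?'p = 'p, of m] by (simp add: zmod_zmult2_eq)
    finally show "f (Suc m) mod ?P ^ m = f m"
      unfolding f_def using padic_card_pos[where ?'p = 'p, of n] by simp
  qed
  define y :: "'p padic_int" where "y = Abs_padic_int f"
  have "x = of_nat (CARD('p) ^ n) * y"
    unfolding Rep_padic_int_inject[symmetric]
  proof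
    fix m
    have "?P ^ n * f m = Rep_padic_int x (n + m)"
      unfolding f_def using dv[of m] by simp
    then have "?P ^ n * f m mod ?P ^ m = Rep_padic_int x m"
      using Rep_padic_int_mod[of m "n + m" x] by simp
    then show "Rep_padic_int x m = Rep_padic_int (of_nat (CARD('p) ^ n) * y) m"
      using f by (simp add: times_padic_int.rep_eq Rep_padic_int_of_nat Abs_padic_int_inverse y_def mod_simps
          del: of_nat_power) (simp add: mod_simps)
  qed
  then show "of_nat CARD('p) ^ n dvd x"
    by simp
qed

lemma padic_int_approx:
  fixes x :: "'p :: prime_card padic_int"
  obtains m :: nat where "m > 0" "of_nat CARD('p) ^ k dvd x - of_nat m"
proof
  \<comment> \<open>Adding \<open>p^k\<close> keeps the residue class and makes the integer
    positive, as the limit that defines \<open>padic_gamma\<close> runs over positive integers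
    only.\<close>
  let ?m = "nat (Rep_padic_int x k) + CARD('p) ^ k"
  show "?m > 0"
    by simp
  show "of_nat CARD('p) ^ k dvd x - of_nat ?m"
    using Rep_padic_int_bounds(1)[of x k]
    by (simp add: padic_dvd_iff minus_padic_int.rep_eq Rep_padic_int_of_nat mod_simps del: of_nat_power of_nat_add)
      (simp add: mod_simps)
qed

text \<open>The inverse is assembled from the inverses modulo \<open>p^n\<close>, which are
  compatible because an inverse modulo \<open>p^n\<close> is unique.\<close>

lemma padic_int_unit:
  fixes x :: "'p :: prime_card padic_int"
  assumes "\<not> of_nat CARD('p) dvd x"
  shows "x dvd 1"
proof -
  let ?P = "int CARD('p)"
  let ?X = "Rep_padic_int x"
  have X1: "?X 1 \<noteq> 0"
    using assms padic_dvd_iff[of 1 x] by simp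
  have cop: "coprime (?X n) (?P ^ n)" for n
  proof (cases n)
    case (Suc m)
    have "?X n mod ?P = ?X 1"
      using Rep_padic_int_mod[of 1 n x] Suc by simp
    then have "\<not> ?P dvd ?X n"
      using X1 by (auto simp: dvd_eq_mod_eq_0)
    then have "coprime ?P (?X n)"
      using prime_card_int[where ?'a = 'p] by (intro prime_imp_coprime) auto
    then show ?thesis
      by (simp add: coprime_commute)
  qed auto
  define f where "f = (\<lambda>n. modular_inverse (?P ^ n) (?X n))"
  have inv: "[?X n * f n = 1] (mod ?P ^ n)" for n
    unfolding f_def using cong_modular_inverse1[OF cop] .
  have f: "f \<in> {x. \<forall>n. x n \<in> {0..<?P ^ n} \<and> x (Suc n) mod ?P ^ n = x n}"
  proof (clarify, intro conjI)
    fix n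
    show fn: "f n \<in> {0..<?P ^ n}" for n
      unfolding f_def using padic_card_pos[where ?'p = 'p, of n]
      by (simp add: modular_inverse_int_nonneg modular_inverse_int_less)
    have "[?X (Suc n) * f (Suc n) = 1] (mod ?P ^ n)"
      using inv[of "Suc n"] by (rule cong_dvd_modulus) simp
    moreover have "[?X (Suc n) = ?X n] (mod ?P ^ n)"
      using Rep_padic_int_mod[of n "Suc n" x] Rep_padic_int_mod[of n "n" x] by (simp add: cong_def)
    ultimately have "[?X n * f (Suc n) = 1] (mod ?P ^ n)"
      by (meson cong_scalar_right cong_sym cong_trans)
    then have "[?X n * f (Suc n) = ?X n * f n] (mod ?P ^ n)"
      using inv[of n] cong_sym cong_trans by blast
    then have "[f (Suc n) = f n] (mod ?P ^ n)"
      using cop[of n] by (simp add: cong_mult_lcancel)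
    then show "f (Suc n) mod ?P ^ n = f n"
      using fn[of n] by (simp add: cong_def)
  qed
  have "x * Abs_padic_int f = (1 :: 'p padic_int)"
    unfolding Rep_padic_int_inject[symmetric]
  proof
    fix n
    show "Rep_padic_int (x * Abs_padic_int f) n = Rep_padic_int (1 :: 'p padic_int) n"
      using f inv[of n]
      by (simp add: times_padic_int.rep_eq one_padic_int.rep_eq Abs_padic_int_inverse cong_def)
  qed
  then show ?thesis
    by (metis dvd_triv_left)
qed

section \<open>Morita's gamma function at natural numbers and its p-adic continuity\<close>

lemma padic_gamma_nat_0 [simp]: "padic_gamma_nat 0 = 1"
  by (simp add: padic_gamma_nat_def)

lemma padic_gamma_nat_Suc:
  "(padic_gamma_nat (Suc n) :: 'p :: prime_card padic_int) =
     - (if CARD('p) dvd n then 1 else of_nat n) * padic_gamma_nat n"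
proof -
  have eq: "{j. 0 < j \<and> j < Suc n \<and> \<not> CARD('p) dvd j} =
      (if CARD('p) dvd n then {} else {n}) \<union> {j. 0 < j \<and> j < n \<and> \<not> CARD('p) dvd j}"
    by (auto simp: less_Suc_eq intro!: Nat.gr0I)
  have "(\<Prod>j | 0 < j \<and> j < Suc n \<and> \<not> CARD('p) dvd j. of_nat j :: 'p padic_int) =
      (\<Prod>j \<in> (if CARD('p) dvd n then {} else {n}). of_nat j) *
      (\<Prod>j | 0 < j \<and> j < n \<and> \<not> CARD('p) dvd j. of_nat j)"
    unfolding eq by (subst prod.union_disjoint) auto
  then show ?thesis
    by (simp add: padic_gamma_nat_def)
qed

text \<open>Taylor expansion to first order in \<open>x\<close>: the linear coefficient collects the
  products with one factor left out.\<close>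

lemma prod_add_expand:
  fixes f :: "'a \<Rightarrow> 'b :: comm_ring_1"
  assumes "finite A"
  shows "x ^ 2 dvd (\<Prod>i\<in>A. x + f i) - (prod f A + x * (\<Sum>i\<in>A. prod f (A - {i})))"
  using assms
proof (induction A rule: finite_induct)
  case (insert a A)
  let ?S = "\<Sum>i\<in>A. prod f (A - {i})"
  obtain z where z: "(\<Prod>i\<in>A. x + f i) = prod f A + x * ?S + x ^ 2 * z"
    using insert.IH by (auto simp: dvd_def algebra_simps)
  have "(\<Sum>i\<in>A. prod f (insert a A - {i})) = (\<Sum>i\<in>A. f a * prod f (A - {i}))"
  proof (rule sum.cong)
    fix i assume "i \<in> A"
    then have "insert a A - {i} = insert a (A - {i})"
      using insert by auto
    then show "prod f (insert a A - {i}) = f a * prod f (A - {i})"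
      using insert by simp
  qed simp
  then have "(\<Sum>i\<in>insert a A. prod f (insert a A - {i})) = prod f A + f a * ?S"
    using insert by (simp add: sum_distrib_left)
  then have "(\<Prod>i\<in>insert a A. x + f i) -
      (prod f (insert a A) + x * (\<Sum>i\<in>insert a A. prod f (insert a A - {i}))) =
      x ^ 2 * (?S + (x + f a) * z)"
    using insert z by (simp add: algebra_simps power2_eq_square)
  then show ?case
    by simp
qed simp

definition punits :: "nat \<Rightarrow> nat \<Rightarrow> nat set" where
  "punits p n = {j. 0 < j \<and> j < n \<and> \<not> p dvd j}"

lemma finite_punits [simp]: "finite (punits p n)"
  by (simp add: punits_def)

text \<open>Adding the multiple \<open>i\<close> of \<open>p\<close> does not change which integers
  are divisible by \<open>p\<close>, so the factors picked up after \<open>i\<close> are those of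
  the first \<open>n\<close> positions, shifted by \<open>i\<close>.\<close>

lemma padic_gamma_nat_shift:
  assumes "CARD('p :: prime_card) dvd i"
  shows "(padic_gamma_nat (i + n) :: 'p padic_int) =
     padic_gamma_nat i * ((- 1) ^ n * (\<Prod>j\<in>punits CARD('p) n. of_nat i + of_nat j))"
proof (induction n)
  case 0
  then show ?case by (simp add: punits_def)
next
  case (Suc n)
  have eq: "punits CARD('p) (Suc n) =
      (if CARD('p) dvd n then {} else {n}) \<union> punits CARD('p) n"
    by (auto simp: less_Suc_eq punits_def intro!: Nat.gr0I)
  have "(\<Prod>j\<in>punits CARD('p) (Suc n). of_nat i + of_nat j :: 'p padic_int) =
      (\<Prod>j \<in> (if CARD('p) dvd n then {} else {n}). of_nat i + of_nat j) *
      (\<Prod>j\<in>punits CARD('p) n. of_nat i + of_nat j)"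
    unfolding eq by (subst prod.union_disjoint) (auto simp: punits_def)
  moreover have "CARD('p) dvd i + n \<longleftrightarrow> CARD('p) dvd n"
    using assms by (simp add: dvd_add_right_iff)
  ultimately show ?case
    using Suc by (simp add: padic_gamma_nat_Suc)
qed

text \<open>The block of factors between \<open>i p^k\<close> and \<open>(i + 1) p^k\<close> is the
  first block with every factor shifted by \<open>x = i p^k\<close>. In its expansion in
  \<open>x\<close> the quadratic remainder is divisible by \<open>p^(2k)\<close>. The minus sign in
  \<open>c\<close> is \<open>(-1)^(p^k)\<close> for odd \<open>p\<close>.\<close>

lemma padic_gamma_nat_add_multiple:
  fixes c :: "'p :: prime_card padic_int"
  assumes "odd CARD('p)" "k \<ge> 1"
    and c: "c = - (\<Sum>j\<in>punits CARD('p) (CARD('p) ^ k). \<Prod>l\<in>punits CARD('p) (CARD('p) ^ k) - {j}. of_nat l)"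
  shows "of_nat CARD('p) ^ (2 * k) dvd padic_gamma_nat (i * CARD('p) ^ k + CARD('p) ^ k) -
       padic_gamma_nat (i * CARD('p) ^ k) * (padic_gamma_nat (CARD('p) ^ k) + of_nat i * of_nat CARD('p) ^ k * c)"
proof -
  let ?q = "CARD('p) ^ k"
  let ?A = "punits CARD('p) ?q"
  define u :: "'p padic_int" where "u = padic_gamma_nat ?q"
  have "odd ?q"
    using assms by simp
  then have u: "u = - (\<Prod>j\<in>?A. of_nat j)"
    by (simp add: u_def padic_gamma_nat_def punits_def)
  let ?x = "of_nat (i * ?q) :: 'p padic_int"
  obtain z where z: "(\<Prod>j\<in>?A. ?x + of_nat j) = - u + ?x * (- c) + ?x ^ 2 * z"
    using prod_add_expand[of ?A ?x of_nat] by (auto simp: u c dvd_def algebra_simps)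
  have "CARD('p) dvd i * ?q"
    using assms by (simp add: dvd_power)
  from padic_gamma_nat_shift[OF this, of ?q]
  have "padic_gamma_nat (i * ?q + ?q) = padic_gamma_nat (i * ?q) * (u + ?x * c - ?x ^ 2 * z)"
    unfolding z using \<open>odd ?q\<close> by (simp only: minus_one_power_iff if_False) (simp add: algebra_simps)
  moreover have "(of_nat CARD('p) :: 'p padic_int) ^ (2 * k) = of_nat CARD('p) ^ k * of_nat CARD('p) ^ k"
    by (simp add: mult_2 power_add)
  ultimately have "padic_gamma_nat (i * ?q + ?q) -
     padic_gamma_nat (i * ?q) * (u + of_nat i * of_nat CARD('p) ^ k * c) =
     of_nat CARD('p) ^ (2 * k) * (- (of_nat i ^ 2 * z * padic_gamma_nat (i * ?q)))"
    by (simp add: algebra_simps power2_eq_square)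
  then show ?thesis
    by (simp add: u_def)
qed

lemma dvd_diff_sym: "a dvd b - c \<Longrightarrow> a dvd c - b" for a b c :: "'a :: comm_ring_1"
  by (metis dvd_minus_iff minus_diff_eq)

lemma padic_of_nat_dvd_iff:
  "of_nat CARD('p) ^ k dvd (of_nat m - of_nat n :: 'p :: prime_card padic_int) \<longleftrightarrow>
     int CARD('p) ^ k dvd int m - int n"
  by (simp add: padic_dvd_iff minus_padic_int.rep_eq Rep_padic_int_of_nat mod_simps dvd_eq_mod_eq_0)

lemma punits_prime:
  assumes "prime p"
  shows "punits p p = {1..p - 1}"
proof -
  have "\<not> p dvd j" if "0 < j" "j < p" for j
    using that by (rule nat_dvd_not_less)
  moreover have "p > 0"
    using assms by (rule prime_gt_0_nat)
  ultimately show ?thesis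
    by (auto simp: punits_def)
qed

text \<open>Multiplies \<open>m\<close> consecutive blocks. Products of two first-order terms vanish
  modulo \<open>p^(k+1)\<close> because \<open>2k >= k + 1\<close>, so the contributions
  \<open>u + i c\<close> of the blocks simply add up.\<close>

lemma padic_gamma_nat_mult_power:
  assumes "odd CARD('p :: prime_card)" "k \<ge> 1"
    and u: "padic_gamma_nat (CARD('p) ^ k) = 1 + of_nat CARD('p) ^ k * u"
    and c: "c = - (\<Sum>j\<in>punits CARD('p) (CARD('p) ^ k). \<Prod>l\<in>punits CARD('p) (CARD('p) ^ k) - {j}. of_nat l)"
  shows "of_nat CARD('p) ^ Suc k dvd padic_gamma_nat (m * CARD('p) ^ k) -
    (1 + of_nat CARD('p) ^ k * (of_nat m * u + of_nat (\<Sum>i<m. i) * c) :: 'p padic_int)"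
proof (induction m)
  case (Suc m)
  let ?P = "of_nat CARD('p) :: 'p padic_int"
  define b where "b = of_nat (\<Sum>i<m. i) * c"
  define v where "v = of_nat m * u + b"
  define w where "w = u + of_nat m * c"
  have kk: "?P ^ Suc k dvd ?P ^ (2 * k)"
    using assms(2) by (intro le_imp_power_dvd) auto
  have 1: "?P ^ Suc k dvd padic_gamma_nat (Suc m * CARD('p) ^ k) -
       padic_gamma_nat (m * CARD('p) ^ k) * (1 + ?P ^ k * w)"
    using dvd_trans[OF kk padic_gamma_nat_add_multiple[OF assms(1,2) c, of m]]
    by (simp add: u w_def algebra_simps)
  have 2: "?P ^ Suc k dvd padic_gamma_nat (m * CARD('p) ^ k) - (1 + ?P ^ k * v)"
    using Suc by (simp add: v_def b_def)
  have "?P ^ Suc k dvd (padic_gamma_nat (Suc m * CARD('p) ^ k) -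
       padic_gamma_nat (m * CARD('p) ^ k) * (1 + ?P ^ k * w))
     + (padic_gamma_nat (m * CARD('p) ^ k) - (1 + ?P ^ k * v)) * (1 + ?P ^ k * w) + ?P ^ (2 * k) * (v * w)"
    using 1 2 kk by (intro dvd_add) (auto intro: dvd_mult2)
  also have "?P ^ (2 * k) = ?P ^ k * ?P ^ k"
    by (simp add: power_add mult_2)
  finally have "?P ^ Suc k dvd padic_gamma_nat (Suc m * CARD('p) ^ k) - (1 + ?P ^ k * (v + w))"
    by (simp add: algebra_simps)
  moreover have "v + w = of_nat (Suc m) * u + of_nat (\<Sum>i<Suc m. i) * c"
    unfolding v_def w_def b_def by (simp add: algebra_simps)
  ultimately show ?case by simp
qed simp

lemma padic_gamma_nat_prime:
  assumes "odd CARD('p :: prime_card)"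
  shows "(padic_gamma_nat CARD('p) :: 'p padic_int) = - of_nat (fact (CARD('p) - 1))"
  using assms punits_prime[OF prime_card[where ?'a = 'p]]
  by (simp add: padic_gamma_nat_def punits_def fact_prod)

text \<open>Generalises Wilson's theorem, which is the case \<open>k = 1\<close>. For the step from
  \<open>k\<close> to \<open>k + 1\<close>, \<open>p\<close> blocks of length \<open>p^k\<close> are
  composed: the correction \<open>p u + (0 + ... + (p - 1)) c\<close> is a multiple of
  \<open>p\<close>, since \<open>0 + ... + (p - 1)\<close> is one for odd \<open>p\<close>.\<close>

lemma padic_gamma_nat_power:
  assumes "odd CARD('p :: prime_card)"
  shows "of_nat CARD('p) ^ k dvd padic_gamma_nat (CARD('p) ^ k) - (1 :: 'p padic_int)"
proof (induction k)
  case (Suc k)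
  let ?P = "of_nat CARD('p) :: 'p padic_int"
  show ?case
  proof (cases "k = 0")
    case True
    have "[fact (CARD('p) - 1) = - 1] (mod int CARD('p))"
      by (rule wilson_theorem) (rule prime_card)
    then have "int CARD('p) dvd int (fact (CARD('p) - 1) + 1) - int 0"
      by (simp add: cong_iff_dvd_diff add.commute)
    then have "?P dvd of_nat (fact (CARD('p) - 1) + 1) - of_nat 0"
      using padic_of_nat_dvd_iff[where ?'p = 'p, of 1 "fact (CARD('p) - 1) + 1" 0] by simp
    then have "?P dvd - (- of_nat (fact (CARD('p) - 1)) - 1)"
      by simp
    then show ?thesis
      using True padic_gamma_nat_prime[OF assms] by (metis dvd_minus_iff power_Suc0_right)
  next
    case False
    obtain u where "padic_gamma_nat (CARD('p) ^ k) - 1 = ?P ^ k * u"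
      using Suc by (auto simp: dvd_def)
    then have u: "padic_gamma_nat (CARD('p) ^ k) = 1 + ?P ^ k * u"
      by (simp add: algebra_simps)
    define c where "c = - (\<Sum>j\<in>punits CARD('p) (CARD('p) ^ k). \<Prod>l\<in>punits CARD('p) (CARD('p) ^ k) - {j}. (of_nat l :: 'p padic_int))"
    obtain t where t: "CARD('p) = 2 * t + 1"
      using assms by (elim oddE)
    have "2 * (\<Sum>i<n. i) = n * (n - 1)" for n :: nat
      by (induction n) (auto simp: algebra_simps diff_mult_distrib)
    from this[of "CARD('p)"] have s: "(\<Sum>i<CARD('p). i) = CARD('p) * t"
      using t by simp
    have "?P ^ Suc k dvd padic_gamma_nat (CARD('p) * CARD('p) ^ k) -
        (1 + ?P ^ k * (?P * u + of_nat (\<Sum>i<CARD('p). i) * c))"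
      using padic_gamma_nat_mult_power[OF assms _ u c_def, of "CARD('p)"] False by simp
    then have "?P ^ Suc k dvd padic_gamma_nat (CARD('p) * CARD('p) ^ k) -
        (1 + ?P ^ k * (?P * u + of_nat (\<Sum>i<CARD('p). i) * c)) + ?P ^ Suc k * (u + of_nat t * c)"
      by (rule dvd_add) simp
    then show ?thesis
      by (simp only: s) (simp add: algebra_simps)
  qed
qed simp

text \<open>The case \<open>n = 0\<close> is \<open>padic_gamma_nat_power\<close>. The functional
  equation carries it upwards, as its factors at \<open>n\<close> and at \<open>n + p^k\<close>
  agree modulo \<open>p^k\<close>.\<close>

lemma padic_gamma_nat_add_power:
  assumes "odd CARD('p :: prime_card)"
  shows "of_nat CARD('p) ^ k dvd padic_gamma_nat (n + CARD('p) ^ k) - (padic_gamma_nat n :: 'p padic_int)"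
proof (cases "k = 0")
  case False
  let ?P = "of_nat CARD('p) :: 'p padic_int"
  show ?thesis
  proof (induction n)
    case 0
    show ?case using padic_gamma_nat_power[OF assms, of k] by simp
  next
    case (Suc n)
    define v :: "'p padic_int" where "v = (if CARD('p) dvd n then 1 else of_nat n)"
    define w :: "'p padic_int" where "w = (if CARD('p) dvd n then 0 else 1)"
    have "CARD('p) dvd n + CARD('p) ^ k \<longleftrightarrow> CARD('p) dvd n"
      using False by (simp add: dvd_add_left_iff)
    then have "padic_gamma_nat (Suc n + CARD('p) ^ k) = - (v + w * ?P ^ k) * padic_gamma_nat (n + CARD('p) ^ k)"
      by (simp add: padic_gamma_nat_Suc v_def w_def algebra_simps)
    moreover have "padic_gamma_nat (Suc n) = - v * padic_gamma_nat n"
      by (simp add: padic_gamma_nat_Suc v_def)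
    ultimately have "padic_gamma_nat (Suc n + CARD('p) ^ k) - padic_gamma_nat (Suc n) =
      - v * (padic_gamma_nat (n + CARD('p) ^ k) - padic_gamma_nat n) - w * ?P ^ k * padic_gamma_nat (n + CARD('p) ^ k)"
      by (simp add: algebra_simps)
    then show ?case
      using Suc by (metis dvd_diff dvd_mult dvd_mult2 dvd_triv_right)
  qed
qed simp

lemma padic_gamma_nat_cong:
  assumes "odd CARD('p :: prime_card)"
    and "of_nat CARD('p) ^ k dvd (of_nat m - of_nat n :: 'p padic_int)"
  shows "of_nat CARD('p) ^ k dvd (padic_gamma_nat m - padic_gamma_nat n :: 'p padic_int)"
proof -
  let ?P = "of_nat CARD('p) :: 'p padic_int"
  have add: "?P ^ k dvd padic_gamma_nat (n + t * CARD('p) ^ k) - padic_gamma_nat n" for n t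
  proof (induction t)
    case (Suc t)
    from dvd_add[OF padic_gamma_nat_add_power[OF assms(1), of k "n + t * CARD('p) ^ k"] Suc]
    show ?case by (simp add: algebra_simps)
  qed simp
  have dv: "int (CARD('p) ^ k) dvd int m - int n"
    using assms(2) by (simp add: padic_of_nat_dvd_iff)
  show ?thesis
  proof (cases "n \<le> m")
    case True
    then have "CARD('p) ^ k dvd m - n"
      using dv by (metis of_nat_diff of_nat_dvd_iff)
    then obtain t where "m = n + t * CARD('p) ^ k"
      using True by (metis dvd_def le_add_diff_inverse mult.commute)
    then show ?thesis
      using add by simp
  next
    case False
    then have "CARD('p) ^ k dvd n - m"
      using dv by (metis dvd_diff_commute nat_le_linear of_nat_diff of_nat_dvd_iff)
    then obtain t where "n = m + t * CARD('p) ^ k"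
      using False by (metis dvd_def le_add_diff_inverse mult.commute nat_le_linear)
    then show ?thesis
      using add[of m t, THEN dvd_diff_sym] by simp
  qed
qed

text \<open>On natural numbers the function preserves congruences modulo \<open>p^k\<close>. Hence
  its values at integers that approach \<open>x\<close> have coherent residues; these define a
  p-adic integer \<open>L\<close>, which is then identified with the limit in
  \<open>padic_gamma\<close>.\<close>

lemma padic_gamma_approx:
  fixes x :: "'p :: prime_card padic_int"
  assumes odd: "odd CARD('p)" and x: "of_nat CARD('p) ^ k dvd x - of_nat n"
  shows "of_nat CARD('p) ^ k dvd padic_gamma x - padic_gamma_nat n"
proof -
  let ?P = "of_nat CARD('p) :: 'p padic_int"
  have tri: "?P ^ k dvd a - c" if "?P ^ k dvd a - b" "?P ^ k dvd b - c" for a b c k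
    using dvd_add[OF that] by simp
  have "\<exists>m. m > 0 \<and> ?P ^ k dvd x - of_nat m" for k
    using padic_int_approx[of k x] by blast
  then obtain N where N: "\<And>k. N k > 0" "\<And>k. ?P ^ k dvd x - of_nat (N k)"
    by metis
  have NN: "?P ^ k dvd padic_gamma_nat m - padic_gamma_nat (N k)" if "?P ^ k dvd x - of_nat m" for k m
  proof -
    have "?P ^ k dvd of_nat m - x"
      using that by (rule dvd_diff_sym)
    from padic_gamma_nat_cong[OF odd tri[OF this N(2)]] show ?thesis .
  qed
  define f where "f = (\<lambda>k. Rep_padic_int (padic_gamma_nat (N k) :: 'p padic_int) k)"
  have f: "f \<in> {x. \<forall>n. x n \<in> {0..<int CARD('p) ^ n} \<and> x (Suc n) mod int CARD('p) ^ n = x n}"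
  proof (clarify, intro conjI)
    fix k
    show "f k \<in> {0..<int CARD('p) ^ k}"
      unfolding f_def using Rep_padic_int_bounds by auto
    have "?P ^ k dvd ?P ^ Suc k"
      by simp
    then have "?P ^ k dvd x - of_nat (N (Suc k))"
      using N(2)[of "Suc k"] dvd_trans by blast
    from NN[OF this] have "(Rep_padic_int (padic_gamma_nat (N (Suc k)) :: 'p padic_int) k
        - Rep_padic_int (padic_gamma_nat (N k) :: 'p padic_int) k) mod int CARD('p) ^ k = 0"
      by (simp add: padic_dvd_iff minus_padic_int.rep_eq)
    then have "Rep_padic_int (padic_gamma_nat (N (Suc k)) :: 'p padic_int) k =
        Rep_padic_int (padic_gamma_nat (N k) :: 'p padic_int) k"
      by (intro cong_less_imp_eq_int[of _ "int CARD('p) ^ k"] Rep_padic_int_bounds)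
        (simp add: cong_iff_dvd_diff dvd_eq_mod_eq_0)
    then show "f (Suc k) mod int CARD('p) ^ k = f k"
      unfolding f_def using Rep_padic_int_mod[of k "Suc k" "padic_gamma_nat (N (Suc k)) :: 'p padic_int"]
      by simp
  qed
  define L :: "'p padic_int" where "L = Abs_padic_int f"
  have L: "?P ^ k dvd padic_gamma_nat (N k) - L" for k
  proof -
    have "Rep_padic_int L k = Rep_padic_int (padic_gamma_nat (N k) :: 'p padic_int) k"
      using f by (simp add: L_def Abs_padic_int_inverse f_def)
    then show ?thesis
      by (simp add: padic_dvd_iff minus_padic_int.rep_eq)
  qed
  have key: "?P ^ k dvd padic_gamma_nat m - L" if "?P ^ k dvd x - of_nat m" for k m
    using NN[OF that] L tri by blast
  have ball: "open {y. ?P ^ k dvd y - x}" for k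
    unfolding open_padic_int_def by (auto intro!: exI[of _ k] intro: tri)
  let ?F = "inf (filtercomap of_nat (nhds x)) (principal {0<..})"
  have "(padic_gamma_nat \<longlongrightarrow> L) ?F"
  proof (rule topological_tendstoI)
    fix S assume "open S" "L \<in> S"
    then obtain k where k: "\<And>y. ?P ^ k dvd y - L \<Longrightarrow> y \<in> S"
      unfolding open_padic_int_def by blast
    have "\<forall>\<^sub>F y in nhds x. ?P ^ k dvd y - x"
      using ball[of k] by (auto simp: eventually_nhds)
    then have "\<forall>\<^sub>F m in filtercomap of_nat (nhds x). ?P ^ k dvd of_nat m - x"
      by (rule eventually_filtercomapI)
    then show "\<forall>\<^sub>F m in ?F. padic_gamma_nat m \<in> S"
      unfolding eventually_inf_principal
    proof eventually_elim
      case (elim m)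
      then show ?case
        using k[OF key[OF dvd_diff_sym]] by blast
    qed
  qed
  \<comment> \<open>\<open>Lim\<close> is determined only along a nontrivial filter: every
    neighbourhood of \<open>x\<close> has to contain a positive integer, and the approximations
    \<open>N k\<close> provide one.\<close>
  moreover have "?F \<noteq> bot"
  proof
    assume "?F = bot"
    then have "\<forall>\<^sub>F m in filtercomap of_nat (nhds x). \<not> m > (0 :: nat)"
      by (simp add: trivial_limit_def eventually_inf_principal)
    then obtain Q where Q: "eventually Q (nhds x)" "\<And>m. Q (of_nat m) \<Longrightarrow> \<not> m > 0"
      unfolding eventually_filtercomap by blast
    from Q(1) obtain S where "open S" "x \<in> S" "\<And>y. y \<in> S \<Longrightarrow> Q y"
      unfolding eventually_nhds by blast
    with Q(2) have S: "open S" "x \<in> S" "\<And>m. of_nat m \<in> S \<Longrightarrow> \<not> m > 0"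
      by blast+
    then obtain k where k: "\<And>y. ?P ^ k dvd y - x \<Longrightarrow> y \<in> S"
      unfolding open_padic_int_def by blast
    show False
      using S(3)[of "N k"] k[OF dvd_diff_sym, OF N(2)] N(1)[of k] by blast
  qed
  ultimately have "padic_gamma x = L"
    unfolding padic_gamma_def by (intro tendsto_Lim)
  then show ?thesis
    using key[OF x, THEN dvd_diff_sym] by simp
qed

section \<open>Units of the p-adic integers and first-order expansions\<close>

definition padic_p :: "'p :: prime_card padic" where
  "padic_p = of_nat CARD('p)"

lemma padic_p_nonzero [simp]: "padic_p \<noteq> 0"
  by (simp add: padic_p_def)

lemma to_fract_of_nat [simp]: "to_fract (of_nat n) = of_nat n"
  by (induction n) simp_all

lemma to_fract_prod: "to_fract (prod f A) = (\<Prod>x\<in>A. to_fract (f x))"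
  by (induction A rule: infinite_finite_induct) simp_all

lemma to_fract_in_Zp [simp]: "to_fract z \<in> \<int>\<^sub>p"
  by (simp add: padic_integers_def)

lemma ZpE:
  assumes "x \<in> \<int>\<^sub>p"
  obtains z where "x = to_fract z"
  using assms by (auto simp: padic_integers_def)

lemma Zp_0 [simp]: "0 \<in> \<int>\<^sub>p"
  using to_fract_in_Zp[of 0] by simp

lemma Zp_1 [simp]: "1 \<in> \<int>\<^sub>p"
  using to_fract_in_Zp[of 1] by simp

lemma Zp_of_nat [simp]: "of_nat n \<in> \<int>\<^sub>p"
  using to_fract_in_Zp[of "of_nat n"] by simp

lemma Zp_padic_p [simp]: "padic_p \<in> \<int>\<^sub>p"
  by (simp add: padic_p_def)

lemma Zp_add [simp]: "x \<in> \<int>\<^sub>p \<Longrightarrow> y \<in> \<int>\<^sub>p \<Longrightarrow> x + y \<in> \<int>\<^sub>p"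
  by (metis ZpE to_fract_add to_fract_in_Zp)

lemma Zp_diff [simp]: "x \<in> \<int>\<^sub>p \<Longrightarrow> y \<in> \<int>\<^sub>p \<Longrightarrow> x - y \<in> \<int>\<^sub>p"
  by (metis ZpE to_fract_diff to_fract_in_Zp)

lemma Zp_uminus [simp]: "x \<in> \<int>\<^sub>p \<Longrightarrow> - x \<in> \<int>\<^sub>p"
  by (metis ZpE to_fract_uminus to_fract_in_Zp)

lemma Zp_mult [simp]: "x \<in> \<int>\<^sub>p \<Longrightarrow> y \<in> \<int>\<^sub>p \<Longrightarrow> x * y \<in> \<int>\<^sub>p"
  by (metis ZpE to_fract_mult to_fract_in_Zp)

lemma Zp_power [simp]: "x \<in> \<int>\<^sub>p \<Longrightarrow> x ^ n \<in> \<int>\<^sub>p"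
  by (induction n) simp_all

lemma Zp_sum: "(\<And>i. i \<in> A \<Longrightarrow> f i \<in> \<int>\<^sub>p) \<Longrightarrow> sum f A \<in> \<int>\<^sub>p"
  by (induction A rule: infinite_finite_induct) simp_all

definition padic_units :: "'p :: prime_card padic set" where
  "padic_units = {x \<in> \<int>\<^sub>p. x \<noteq> 0 \<and> inverse x \<in> \<int>\<^sub>p}"

lemma padic_unitsD:
  assumes "x \<in> padic_units"
  shows "x \<in> \<int>\<^sub>p" "x \<noteq> 0" "inverse x \<in> \<int>\<^sub>p"
  using assms by (auto simp: padic_units_def)

lemma padic_units_1 [simp]: "1 \<in> padic_units"
  by (simp add: padic_units_def)

lemma padic_units_mult [simp]: "x \<in> padic_units \<Longrightarrow> y \<in> padic_units \<Longrightarrow> x * y \<in> padic_units"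
  by (simp add: padic_units_def)

lemma padic_units_inverse [simp]: "x \<in> padic_units \<Longrightarrow> inverse x \<in> padic_units"
  by (simp add: padic_units_def)

lemma padic_units_uminus [simp]: "x \<in> padic_units \<Longrightarrow> - x \<in> padic_units"
  by (simp add: padic_units_def)

lemma padic_units_divide [simp]: "x \<in> padic_units \<Longrightarrow> y \<in> padic_units \<Longrightarrow> x / y \<in> padic_units"
  by (simp add: divide_inverse)

lemma padic_units_power [simp]: "x \<in> padic_units \<Longrightarrow> x ^ n \<in> padic_units"
  by (induction n) simp_all

lemma Zp_divide [simp]: "x \<in> \<int>\<^sub>p \<Longrightarrow> y \<in> padic_units \<Longrightarrow> x / y \<in> \<int>\<^sub>p"
  by (simp add: divide_inverse padic_unitsD)

lemma to_fract_unit: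
  fixes z :: "'p :: prime_card padic_int"
  assumes "\<not> of_nat CARD('p) dvd z"
  shows "to_fract z \<in> padic_units"
proof -
  obtain y where y: "1 = z * y"
    using padic_int_unit[OF assms] by (auto simp: dvd_def)
  then have "to_fract z * to_fract y = 1"
    by (metis to_fract_1 to_fract_mult)
  then have "z \<noteq> 0" "inverse (to_fract z) = to_fract y"
    by (auto intro: inverse_unique)
  then show ?thesis
    by (simp add: padic_units_def)
qed

lemma padic_units_of_nat:
  assumes "\<not> CARD('p) dvd n"
  shows "(of_nat n :: 'p :: prime_card padic) \<in> padic_units"
proof -
  have "\<not> of_nat CARD('p) dvd (of_nat n :: 'p padic_int)"
    using assms padic_of_nat_dvd_iff[where ?'p = 'p, of 1 n 0] by simp
  from to_fract_unit[OF this] show ?thesis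
    by simp
qed

lemma padic_units_of_nat' [simp]:
  "0 < n \<Longrightarrow> n < CARD('p) \<Longrightarrow> (of_nat n :: 'p :: prime_card padic) \<in> padic_units"
  by (intro padic_units_of_nat nat_dvd_not_less)

lemma padic_units_fact [simp]:
  "n < CARD('p) \<Longrightarrow> (fact n :: 'p :: prime_card padic) \<in> padic_units"
proof (induction n)
  case (Suc n)
  then show ?case
    using padic_units_of_nat'[where ?'p = 'p, of "Suc n"] by (simp del: of_nat_Suc)
qed simp

lemma padic_units_1_plus:
  assumes "z \<in> \<int>\<^sub>p"
  shows "(1 + padic_p * z :: 'p :: prime_card padic) \<in> padic_units"
proof -
  obtain y where y: "z = to_fract y"
    using assms by (rule ZpE)
  have "\<not> of_nat CARD('p) dvd (1 :: 'p padic_int)"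
    using padic_of_nat_dvd_iff[where ?'p = 'p, of 1 1 0] prime_gt_1_nat[OF prime_card[where ?'a = 'p]]
    by simp
  then have "\<not> of_nat CARD('p) dvd (1 + of_nat CARD('p) * y)"
    by (metis dvd_add_left_iff dvd_triv_left)
  from to_fract_unit[OF this] show ?thesis
    by (simp add: y padic_p_def)
qed

text \<open>States \<open>x = u (1 + p a)\<close> modulo \<open>p^2\<close>. The correction is taken
  relative to the unit \<open>u\<close>, as in a logarithmic derivative, so that the slopes
  \<open>a\<close> add under products and subtract under quotients.\<close>

definition jet :: "'p :: prime_card padic \<Rightarrow> 'p padic \<Rightarrow> 'p padic \<Rightarrow> bool" where
  "jet x u a \<longleftrightarrow> u \<in> padic_units \<and> a \<in> \<int>\<^sub>p \<and> (\<exists>z\<in>\<int>\<^sub>p. x = u * (1 + padic_p * a + padic_p ^ 2 * z))"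

lemma jet_const: "u \<in> padic_units \<Longrightarrow> jet u u 0"
  by (auto simp: jet_def intro!: bexI[of _ 0])

lemma jet_add:
  assumes "u \<in> padic_units" "a \<in> \<int>\<^sub>p"
  shows "jet (u + padic_p * a) u (a / u)"
  using assms padic_unitsD[OF assms(1)]
  by (auto simp: jet_def algebra_simps intro!: bexI[of _ 0])

lemma jet_mult:
  assumes "jet x u a" "jet y v b"
  shows "jet (x * y) (u * v) (a + b)"
proof -
  obtain z w where "z \<in> \<int>\<^sub>p" "w \<in> \<int>\<^sub>p"
    and zw: "x = u * (1 + padic_p * a + padic_p ^ 2 * z)" "y = v * (1 + padic_p * b + padic_p ^ 2 * w)"
    using assms by (auto simp: jet_def)
  moreover have "x * y = u * v * (1 + padic_p * (a + b) + padic_p ^ 2 *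
      (a * b + z + w + padic_p * (a * w + b * z) + padic_p ^ 2 * (z * w)))"
    unfolding zw by (simp add: algebra_simps power2_eq_square)
  ultimately show ?thesis
    using assms unfolding jet_def
    by (auto intro!: bexI[of _ "a * b + z + w + padic_p * (a * w + b * z) + padic_p ^ 2 * (z * w)"])
qed

lemma jet_unit:
  assumes "jet x u a"
  shows "x \<in> padic_units"
proof -
  obtain z where z: "z \<in> \<int>\<^sub>p" "x = u * (1 + padic_p * a + padic_p ^ 2 * z)"
    using assms by (auto simp: jet_def)
  have "1 + padic_p * a + padic_p ^ 2 * z = 1 + padic_p * (a + padic_p * z)"
    by (simp add: algebra_simps power2_eq_square)
  also have "\<dots> \<in> padic_units"
    using assms z by (intro padic_units_1_plus) (auto simp: jet_def)
  finally show ?thesis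
    using assms z by (auto simp: jet_def)
qed

lemma jet_inverse:
  assumes "jet x u a"
  shows "jet (inverse x) (inverse u) (- a)"
proof -
  obtain z where z: "z \<in> \<int>\<^sub>p" "x = u * (1 + padic_p * a + padic_p ^ 2 * z)"
    using assms by (auto simp: jet_def)
  define X where "X = 1 + padic_p * a + padic_p ^ 2 * z"
  \<comment> \<open>Solves \<open>X (1 - p a + p^2 y) = 1\<close>, because
    \<open>X (1 - p a) = 1 - p^2 (a^2 - z + p a z)\<close>.\<close>
  define y where "y = (a ^ 2 - z + padic_p * a * z) / X"
  have u: "u \<in> padic_units" and a: "a \<in> \<int>\<^sub>p"
    using assms by (auto simp: jet_def)
  have "X = inverse u * x"
    using z u by (simp add: X_def padic_unitsD)
  then have X: "X \<in> padic_units"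
    using u jet_unit[OF assms] by simp
  have "X * (1 + padic_p * (- a) + padic_p ^ 2 * y) = X * (1 - padic_p * a) + padic_p ^ 2 * (a ^ 2 - z + padic_p * a * z)"
    using padic_unitsD(2)[OF X] by (simp add: y_def field_simps)
  also have "\<dots> = 1"
    unfolding X_def by (simp add: algebra_simps power2_eq_square)
  finally have "inverse X = 1 + padic_p * (- a) + padic_p ^ 2 * y"
    by (rule inverse_unique)
  then have "inverse x = inverse u * (1 + padic_p * (- a) + padic_p ^ 2 * y)"
    using z by (simp add: X_def)
  moreover have "y \<in> \<int>\<^sub>p"
    using a z X by (simp add: y_def)
  ultimately show ?thesis
    using u a by (auto simp: jet_def)
qed

lemma jet_divide:
  assumes "jet x u a" "jet y v b"
  shows "jet (x / y) (u / v) (a - b)"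
  using jet_mult[OF assms(1) jet_inverse[OF assms(2)]] by (simp add: divide_inverse)

text \<open>The slope counts only modulo \<open>p\<close>: a change by \<open>p t\<close> is
  absorbed by the \<open>p^2\<close> term.\<close>

lemma jet_slope_cong:
  assumes "jet x u a" "b - a = padic_p * t" "t \<in> \<int>\<^sub>p"
  shows "jet x u b"
proof -
  obtain z where z: "z \<in> \<int>\<^sub>p" "x = u * (1 + padic_p * a + padic_p ^ 2 * z)"
    using assms by (auto simp: jet_def)
  have b: "b = a + padic_p * t"
    using assms(2) by (simp add: algebra_simps)
  have "x = u * (1 + padic_p * b + padic_p ^ 2 * (z - t))"
    unfolding z b by (simp add: algebra_simps power2_eq_square)
  then show ?thesis
    using assms z by (auto simp: jet_def b)
qed

lemma jet_shift:
  assumes "jet x u a" "y - x = padic_p ^ 2 * t" "t \<in> \<int>\<^sub>p"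
  shows "jet y u a"
proof -
  obtain z where z: "z \<in> \<int>\<^sub>p" "x = u * (1 + padic_p * a + padic_p ^ 2 * z)"
    using assms by (auto simp: jet_def)
  have u: "u \<in> padic_units"
    using assms by (auto simp: jet_def)
  have "y = x + padic_p ^ 2 * t"
    using assms(2) by (simp add: algebra_simps)
  then have "y = u * (1 + padic_p * a + padic_p ^ 2 * (z + t / u))"
    using z padic_unitsD(2)[OF u] by (simp add: field_simps)
  then show ?thesis
    using assms z u by (auto simp: jet_def)
qed

lemma jet_mod_p:
  assumes "jet x u a"
  obtains z where "z \<in> \<int>\<^sub>p" "x = u + padic_p * z"
proof -
  obtain z where z: "z \<in> \<int>\<^sub>p" "x = u * (1 + padic_p * a + padic_p ^ 2 * z)"
    using assms by (auto simp: jet_def)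
  have "x = u + padic_p * (u * (a + padic_p * z))"
    unfolding z by (simp add: algebra_simps power2_eq_square)
  moreover have "u * (a + padic_p * z) \<in> \<int>\<^sub>p"
    using z assms by (simp add: jet_def padic_unitsD)
  ultimately show ?thesis
    using that by blast
qed

section \<open>Harmonic numbers modulo p\<close>

definition hsum :: "nat \<Rightarrow> 'a :: field_char_0" where
  "hsum n = (\<Sum>i = 1..n. 1 / of_nat i)"

lemma hsum_0 [simp]: "hsum 0 = 0"
  by (simp add: hsum_def)

lemma hsum_Suc: "hsum (Suc n) = hsum n + 1 / of_nat (Suc n)"
  by (simp add: hsum_def)

lemma hsum_Zp [simp]: "n < CARD('p) \<Longrightarrow> (hsum n :: 'p :: prime_card padic) \<in> \<int>\<^sub>p"
  unfolding hsum_def by (intro Zp_sum Zp_divide) auto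

lemma recip_add:
  fixes u v :: "'a :: field"
  assumes "u \<noteq> 0" "v \<noteq> 0" "p = u + v"
  shows "1 / u + 1 / v = p * (1 / (u * v))"
  using assms by (simp add: field_simps)

text \<open>Pairing \<open>i\<close> with \<open>p - i\<close> makes twice the sum a multiple of
  \<open>p\<close>, and \<open>2\<close> is a unit for odd \<open>p\<close>.\<close>

lemma hsum_p_minus_1:
  assumes "odd CARD('p :: prime_card)"
  obtains t where "t \<in> \<int>\<^sub>p" "hsum (CARD('p) - 1) = (padic_p :: 'p padic) * t"
proof -
  let ?h = "hsum (CARD('p) - 1) :: 'p padic"
  define T where "T = (\<Sum>i = 1..CARD('p) - 1. 1 / (of_nat i * of_nat (CARD('p) - i)) :: 'p padic)"
  have "?h = (\<Sum>i = 1..CARD('p) - 1. 1 / of_nat (CARD('p) - i))"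
    unfolding hsum_def by (rule sum.reindex_bij_witness[of _ "\<lambda>i. CARD('p) - i" "\<lambda>i. CARD('p) - i"]) auto
  then have "?h + ?h = (\<Sum>i = 1..CARD('p) - 1. 1 / of_nat i + 1 / of_nat (CARD('p) - i))"
    by (simp add: hsum_def sum.distrib)
  also have "\<dots> = padic_p * T"
    unfolding T_def sum_distrib_left
  proof (rule sum.cong)
    fix i assume "i \<in> {1..CARD('p) - 1}"
    then have "(of_nat i :: 'p padic) \<noteq> 0" "(of_nat (CARD('p) - i) :: 'p padic) \<noteq> 0"
      "padic_p = of_nat i + (of_nat (CARD('p) - i) :: 'p padic)"
      by (auto simp: padic_p_def simp flip: of_nat_add)
    then show "1 / of_nat i + 1 / of_nat (CARD('p) - i) =
        padic_p * (1 / (of_nat i * of_nat (CARD('p) - i)) :: 'p padic)"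
      by (rule recip_add)
  qed simp
  finally have "?h = padic_p * (T / of_nat 2)"
    by (simp add: mult.commute)
  moreover have "T \<in> \<int>\<^sub>p"
    unfolding T_def by (intro Zp_sum Zp_divide padic_units_mult padic_units_of_nat') auto
  moreover have "(of_nat 2 :: 'p padic) \<in> padic_units"
    using assms by (intro padic_units_of_nat) (metis dvd_refl primes_dvd_imp_eq prime_card two_is_prime_nat)
  ultimately show ?thesis
    using that[of "T / of_nat 2"] Zp_divide by blast
qed

text \<open>Passing from \<open>i\<close> to \<open>i + 1\<close> changes the difference by
  \<open>-(1/(i + 1) + 1/(p - i - 1))\<close>, which is a multiple of \<open>p\<close> by the same
  pairing.\<close>

lemma hsum_reflect:
  assumes "odd CARD('p :: prime_card)" "i < CARD('p)"
  shows "\<exists>t\<in>\<int>\<^sub>p. hsum (CARD('p) - 1 - i) - hsum i = (padic_p :: 'p padic) * t"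
  using assms(2)
proof (induction i)
  case 0
  then show ?case using hsum_p_minus_1[OF assms(1)] by force
next
  case (Suc i)
  then obtain t where t: "t \<in> \<int>\<^sub>p" "hsum (CARD('p) - 1 - i) - hsum i = (padic_p :: 'p padic) * t"
    by auto
  let ?u = "of_nat (Suc i) :: 'p padic" and ?v = "of_nat (CARD('p) - Suc i) :: 'p padic"
  have "CARD('p) - 1 - i = Suc (CARD('p) - 1 - Suc i)" "Suc (CARD('p) - 1 - Suc i) = CARD('p) - Suc i"
    using Suc.prems by auto
  then have h: "hsum (CARD('p) - 1 - i) = hsum (CARD('p) - 1 - Suc i) + 1 / ?v"
    by (metis hsum_Suc)
  have u: "?u \<in> padic_units" "?v \<in> padic_units"
    using Suc.prems by (intro padic_units_of_nat'; simp)+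
  have p: "padic_p = ?u + ?v"
    using Suc.prems unfolding padic_p_def by (simp flip: of_nat_add)
  have "1 / ?u + 1 / ?v = padic_p * (1 / (?u * ?v))"
    using padic_unitsD(2)[OF u(1)] padic_unitsD(2)[OF u(2)] p by (rule recip_add)
  moreover have "hsum (CARD('p) - 1 - Suc i) - hsum (Suc i) =
      (hsum (CARD('p) - 1 - i) - hsum i) - (1 / ?u + 1 / ?v)"
    unfolding h by (simp add: hsum_Suc algebra_simps del: of_nat_Suc)
  ultimately have "hsum (CARD('p) - 1 - Suc i) - hsum (Suc i) = padic_p * (t - 1 / (?u * ?v))"
    unfolding t(2) by (simp add: algebra_simps del: of_nat_Suc)
  then show ?case
    using t u by (intro bexI[of _ "t - 1 / (?u * ?v)"]) (auto simp del: of_nat_Suc)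
qed

section \<open>The gamma function modulo the square of p\<close>

lemma to_fract_of_int [simp]: "to_fract (of_int n) = of_int n"
  by (cases n) simp_all

text \<open>In \<open>padic_gamma_nat_mult_power\<close> with \<open>k = 1\<close> the part that is
  quadratic in \<open>m\<close> has the coefficient \<open>c = -(p - 1)! H_{p-1}\<close>. This is
  divisible by \<open>p\<close>, so modulo \<open>p^2\<close> only the linear part
  \<open>m u\<close> remains, and \<open>g\<close> is \<open>u\<close>.\<close>

lemma padic_gamma_nat_multiple_jet:
  assumes odd: "odd CARD('p :: prime_card)"
  obtains g :: "'p :: prime_card padic"
    where "g \<in> \<int>\<^sub>p" "\<And>m. jet (to_fract (padic_gamma_nat (m * CARD('p)))) 1 (of_nat m * g)"
proof -
  let ?P = "of_nat CARD('p) :: 'p padic_int"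
  obtain u where "padic_gamma_nat (CARD('p) ^ 1) - 1 = ?P ^ 1 * u"
    using padic_gamma_nat_power[OF odd, of 1] by (auto simp: dvd_def)
  then have u: "padic_gamma_nat (CARD('p) ^ 1) = 1 + ?P ^ 1 * u"
    by (simp add: algebra_simps)
  define A where "A = {1..CARD('p) - 1}"
  have A: "punits CARD('p) (CARD('p) ^ 1) = A"
    using punits_prime[OF prime_card[where ?'a = 'p]] by (simp add: A_def)
  define c where "c = - (\<Sum>j\<in>punits CARD('p) (CARD('p) ^ 1). \<Prod>l\<in>punits CARD('p) (CARD('p) ^ 1) - {j}. (of_nat l :: 'p padic_int))"
  have "(\<Prod>l\<in>A - {j}. of_nat l :: 'p padic) = fact (CARD('p) - 1) * (1 / of_nat j)" if "j \<in> A" for j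
  proof -
    have "(of_nat j :: 'p padic) \<noteq> 0"
      using that by (auto simp: A_def)
    moreover have "(fact (CARD('p) - 1) :: 'p padic) = of_nat j * (\<Prod>l\<in>A - {j}. of_nat l)"
      using prod.remove[OF _ that, of "of_nat :: nat \<Rightarrow> 'p padic"] by (simp add: A_def fact_prod)
    ultimately show ?thesis
      by simp
  qed
  then have "to_fract c = - (fact (CARD('p) - 1) * hsum (CARD('p) - 1))"
    unfolding c_def A by (simp add: to_fract_prod hsum_def sum_distrib_left A_def)
  moreover obtain t where t: "t \<in> \<int>\<^sub>p" "hsum (CARD('p) - 1) = (padic_p :: 'p padic) * t"
    using hsum_p_minus_1[OF odd] by blast
  ultimately have c: "to_fract c = padic_p * (- (fact (CARD('p) - 1) * t))"
    by simp
  show ?thesis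
  proof
    show "to_fract u \<in> \<int>\<^sub>p"
      by simp
    fix m
    obtain w where w: "padic_gamma_nat (m * CARD('p)) - (1 + ?P * (of_nat m * u + of_nat (\<Sum>i<m. i) * c)) = ?P ^ 2 * w"
      using padic_gamma_nat_mult_power[OF odd order.refl u c_def, of m] by (auto simp: dvd_def power2_eq_square)
    define s :: "'p padic_int" where "s = of_nat (\<Sum>i<m. i)"
    have "padic_gamma_nat (m * CARD('p)) = 1 + ?P * (of_nat m * u + s * c) + ?P ^ 2 * w"
      using w by (simp only: s_def diff_eq_eq) (simp add: ac_simps)
    then have "to_fract (padic_gamma_nat (m * CARD('p))) =
        1 + padic_p * (of_nat m * to_fract u + to_fract s * to_fract c) + padic_p ^ 2 * to_fract w"
      by (simp add: padic_p_def power2_eq_square)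
    also have "\<dots> = 1 * (1 + padic_p * (of_nat m * to_fract u) +
        padic_p ^ 2 * (to_fract w - to_fract s * (fact (CARD('p) - 1) * t)))"
      unfolding c by (simp add: algebra_simps power2_eq_square)
    finally show "jet (to_fract (padic_gamma_nat (m * CARD('p)))) 1 (of_nat m * to_fract u)"
      unfolding jet_def using t
      by (intro conjI bexI[of _ "to_fract w - to_fract s * (fact (CARD('p) - 1) * t)"])
        (auto intro!: Zp_diff Zp_mult padic_unitsD(1)[OF padic_units_fact])
  qed
qed

text \<open>Passes from natural numbers to rationals. If \<open>m\<close> approximates
  \<open>y\<close> modulo \<open>p\<close>, then \<open>N = n + m p\<close> approximates
  \<open>q\<close> modulo \<open>p^2\<close>, so the gamma values at \<open>q\<close> and
  \<open>N\<close> agree modulo \<open>p^2\<close>. The slope \<open>m s\<close> may then be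
  replaced by \<open>y s\<close>, since slopes count only modulo \<open>p\<close>.\<close>

lemma padic_gamma_rat_jetI:
  fixes y :: "'p :: prime_card padic"
  assumes odd: "odd CARD('p)"
    and q: "of_rat q = of_int n + padic_p * y" and y: "y \<in> \<int>\<^sub>p" and s: "s \<in> \<int>\<^sub>p"
    and *: "\<And>m. m > 0 \<Longrightarrow> \<exists>N. int N = n + int m * int CARD('p) \<and>
             jet (to_fract (padic_gamma_nat N :: 'p padic_int)) u (of_nat m * s)"
  shows "jet (padic_gamma_rat q) u (y * s)"
proof -
  let ?P = "of_nat CARD('p) :: 'p padic_int"
  obtain \<eta> where \<eta>: "y = to_fract \<eta>"
    using y by (rule ZpE)
  obtain m where m: "m > 0" "?P ^ 1 dvd \<eta> - of_nat m"
    by (rule padic_int_approx)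
  from m(2) obtain \<zeta> where "\<eta> - of_nat m = ?P * \<zeta>"
    by (auto simp: dvd_def)
  then have \<zeta>: "\<eta> = of_nat m + ?P * \<zeta>"
    by (simp add: algebra_simps)
  obtain N where N: "int N = n + int m * int CARD('p)"
    and jet: "jet (to_fract (padic_gamma_nat N :: 'p padic_int)) u (of_nat m * s)"
    using *[OF m(1)] by blast
  define \<xi> where "\<xi> = of_int n + ?P * \<eta>"
  have "to_fract \<xi> = of_rat q"
    by (simp add: \<xi>_def q \<eta> padic_p_def)
  then have 1: "padic_int_of_rat q = \<xi>"
    unfolding padic_int_of_rat_def by (intro the_equality) (auto intro: to_fract_eq_iff[THEN iffD1])
  have "(of_nat N :: 'p padic_int) = of_int (n + int m * int CARD('p))"
    using N by (metis of_int_of_nat_eq)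
  then have "\<xi> - of_nat N = ?P ^ 2 * \<zeta>"
    by (simp add: \<xi>_def \<zeta> algebra_simps power2_eq_square)
  then have "?P ^ 2 dvd \<xi> - of_nat N"
    by simp
  from padic_gamma_approx[OF odd this] obtain w where "padic_gamma \<xi> - padic_gamma_nat N = ?P ^ 2 * w"
    by (auto simp: dvd_def)
  from arg_cong[OF this, of to_fract]
  have "to_fract (padic_gamma \<xi>) - to_fract (padic_gamma_nat N) = padic_p ^ 2 * to_fract w"
    by (simp add: padic_p_def power2_eq_square)
  then have "jet (padic_gamma_rat q) u (of_nat m * s)"
    unfolding padic_gamma_rat_def 1 by (rule jet_shift[OF jet]) simp
  moreover have "y * s - of_nat m * s = padic_p * (to_fract \<zeta> * s)"
    unfolding \<eta> \<zeta> by (simp add: padic_p_def algebra_simps)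
  ultimately show ?thesis
    by (rule jet_slope_cong) (simp add: s)
qed

text \<open>Climbs from \<open>m p\<close> by the functional equation. The first step, at the
  multiple \<open>m p\<close> of \<open>p\<close>, contributes just \<open>-1\<close>, hence the
  index \<open>Suc n\<close>. The step at \<open>i + m p\<close> contributes the unit
  \<open>-i (1 + p m/i)\<close> of slope \<open>m/i\<close>.\<close>

lemma padic_gamma_nat_jet_pos:
  fixes g :: "'p :: prime_card padic"
  assumes g: "\<And>m. jet (to_fract (padic_gamma_nat (m * CARD('p)))) 1 (of_nat m * g)"
    and "n < CARD('p)"
  shows "jet (to_fract (padic_gamma_nat (Suc n + m * CARD('p)))) ((- 1) ^ Suc n * fact n) (of_nat m * (g + hsum n))"
  using assms(2)
proof (induction n)
  case 0
  have "jet (- 1 * to_fract (padic_gamma_nat (m * CARD('p)))) (- 1 * 1) (0 + of_nat m * g)"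
    by (intro jet_mult jet_const g) simp
  then show ?case
    by (simp add: padic_gamma_nat_Suc)
next
  case (Suc n)
  let ?N = "Suc n + m * CARD('p)"
  have "\<not> CARD('p) dvd ?N"
    unfolding dvd_add_times_triv_right_iff using Suc.prems by (intro nat_dvd_not_less) auto
  then have "to_fract (padic_gamma_nat (Suc ?N)) = (- of_nat (Suc n) + padic_p * (- of_nat m :: 'p padic)) * to_fract (padic_gamma_nat ?N)"
    by (simp add: padic_gamma_nat_Suc padic_p_def algebra_simps)
  moreover have u: "(of_nat (Suc n) :: 'p padic) \<in> padic_units"
    using Suc.prems by (intro padic_units_of_nat') auto
  then have "jet (- of_nat (Suc n) + padic_p * (- of_nat m :: 'p padic)) (- of_nat (Suc n)) (- of_nat m / - of_nat (Suc n))"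
    by (intro jet_add) (auto simp del: of_nat_Suc)
  moreover have "jet (to_fract (padic_gamma_nat ?N)) ((- 1) ^ Suc n * fact n) (of_nat m * (g + hsum n))"
    using Suc by simp
  ultimately have "jet (to_fract (padic_gamma_nat (Suc ?N))) (- of_nat (Suc n) * ((- 1) ^ Suc n * fact n))
     (- of_nat m / - of_nat (Suc n) + of_nat m * (g + hsum n))"
    by (metis jet_mult)
  moreover have "- of_nat (Suc n) * ((- 1) ^ Suc n * fact n) = (- 1) ^ Suc (Suc n) * (fact (Suc n) :: 'p padic)"
    by (simp add: algebra_simps)
  moreover have "- of_nat m / - of_nat (Suc n) + of_nat m * (g + hsum n) = of_nat m * (g + hsum (Suc n))"
    by (simp add: hsum_Suc algebra_simps del: of_nat_Suc)
  ultimately show ?case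
    by (simp only: add_Suc)
qed

text \<open>Descends from \<open>m p\<close> by dividing out the factors \<open>i - m p\<close>,
  each of slope \<open>-m/i\<close>. The condition \<open>m > 0\<close> keeps the natural
  subtraction from being truncated.\<close>

lemma padic_gamma_nat_jet_neg:
  fixes g :: "'p :: prime_card padic"
  assumes g: "\<And>m. jet (to_fract (padic_gamma_nat (m * CARD('p)))) 1 (of_nat m * g)"
    and "n < CARD('p)" and "m > 0"
  shows "jet (to_fract (padic_gamma_nat (m * CARD('p) - n))) (1 / fact n) (of_nat m * (g + hsum n))"
  using assms(2)
proof (induction n)
  case 0
  then show ?case
    using g[of m] by simp
next
  case (Suc n)
  have le: "CARD('p) \<le> m * CARD('p)"
    using assms(3) by simp
  let ?N = "m * CARD('p) - Suc n"
  have N: "Suc ?N = m * CARD('p) - n"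
    using le Suc.prems by linarith
  have "\<not> CARD('p) dvd ?N"
  proof
    assume "CARD('p) dvd ?N"
    moreover have "?N + Suc n = m * CARD('p)"
      using le Suc.prems by linarith
    ultimately have "CARD('p) dvd Suc n"
      by (metis dvd_add_right_iff dvd_triv_right)
    then show False
      using Suc.prems nat_dvd_not_less[of "Suc n" "CARD('p)"] by simp
  qed
  then have "to_fract (padic_gamma_nat (m * CARD('p) - n)) = - (of_nat ?N :: 'p padic) * to_fract (padic_gamma_nat ?N)"
    unfolding N[symmetric] padic_gamma_nat_Suc by (simp del: of_nat_diff)
  moreover have oN: "(of_nat ?N :: 'p padic) = of_nat m * padic_p - of_nat (Suc n)"
    using le Suc.prems by (subst of_nat_diff) (linarith, simp add: padic_p_def)
  ultimately have eq: "to_fract (padic_gamma_nat (m * CARD('p) - n)) =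
      (of_nat (Suc n) + padic_p * (- of_nat m :: 'p padic)) * to_fract (padic_gamma_nat ?N)"
    unfolding oN by (simp add: algebra_simps)
  have u: "(of_nat (Suc n) :: 'p padic) \<in> padic_units"
    using Suc.prems by (intro padic_units_of_nat') auto
  then have j: "jet (of_nat (Suc n) + padic_p * (- of_nat m :: 'p padic)) (of_nat (Suc n)) (- of_nat m / of_nat (Suc n))"
    by (intro jet_add) (auto simp del: of_nat_Suc)
  have "jet (to_fract (padic_gamma_nat (m * CARD('p) - n))) (1 / fact n) (of_nat m * (g + hsum n))"
    using Suc by simp
  from jet_divide[OF this j]
  have "jet (to_fract (padic_gamma_nat ?N)) (1 / fact n / of_nat (Suc n)) (of_nat m * (g + hsum n) - - of_nat m / of_nat (Suc n))"
    unfolding eq using padic_unitsD(2)[OF jet_unit[OF j]] by simp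
  moreover have "1 / fact n / of_nat (Suc n) = (1 / fact (Suc n) :: 'p padic)"
    by (simp add: mult.commute)
  moreover have "of_nat m * (g + hsum n) - - of_nat m / of_nat (Suc n) = of_nat m * (g + hsum (Suc n))"
    by (simp add: hsum_Suc algebra_simps del: of_nat_Suc)
  ultimately show ?case
    by metis
qed

text \<open>
  Modulo \<open>p\<close>, \<open>g\<close> is the logarithmic derivative of \<open>\<Gamma>\<^sub>p\<close> at \<open>0\<close>; the functional equation shifts it
  by harmonic numbers at the other residue classes.
\<close>

definition padic_gamma_slope :: "'p :: prime_card padic \<Rightarrow> bool" where
  "padic_gamma_slope g \<longleftrightarrow>
    (\<forall>q n y. of_rat q = of_nat (Suc n) + padic_p * y \<longrightarrow> y \<in> \<int>\<^sub>p \<longrightarrow> n < CARD('p) \<longrightarrow>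
       jet (padic_gamma_rat q) ((- 1) ^ Suc n * fact n) (y * (g + hsum n))) \<and>
    (\<forall>q n y. of_rat q = - of_nat n + padic_p * y \<longrightarrow> y \<in> \<int>\<^sub>p \<longrightarrow> n < CARD('p) \<longrightarrow>
       jet (padic_gamma_rat q) (1 / fact n) (y * (g + hsum n)))"

lemma padic_gamma_slope_pos:
  fixes g :: "'p :: prime_card padic"
  assumes "padic_gamma_slope g" "of_rat q = of_nat (Suc n) + padic_p * y" "y \<in> \<int>\<^sub>p" "n < CARD('p)"
  shows "jet (padic_gamma_rat q) ((- 1) ^ Suc n * fact n) (y * (g + hsum n))"
  using assms unfolding padic_gamma_slope_def by blast

lemma padic_gamma_slope_neg:
  fixes g :: "'p :: prime_card padic"
  assumes "padic_gamma_slope g" "of_rat q = - of_nat n + padic_p * y" "y \<in> \<int>\<^sub>p" "n < CARD('p)"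
  shows "jet (padic_gamma_rat q) (1 / fact n) (y * (g + hsum n))"
  using assms unfolding padic_gamma_slope_def by blast

lemma padic_gamma_slope_exists:
  assumes odd: "odd CARD('p :: prime_card)"
  obtains g :: "'p :: prime_card padic" where "padic_gamma_slope g"
proof -
  obtain g :: "'p padic" where g: "g \<in> \<int>\<^sub>p"
    "\<And>m. jet (to_fract (padic_gamma_nat (m * CARD('p)))) 1 (of_nat m * g)"
    using padic_gamma_nat_multiple_jet[OF odd] by blast
  show ?thesis
  proof (rule that, unfold padic_gamma_slope_def, intro conjI allI impI)
    fix q n and y :: "'p padic"
    assume *: "of_rat q = of_nat (Suc n) + padic_p * y" "y \<in> \<int>\<^sub>p" "n < CARD('p)"
    show "jet (padic_gamma_rat q) ((- 1) ^ Suc n * fact n) (y * (g + hsum n))"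
    proof (rule padic_gamma_rat_jetI[OF odd, of q "int (Suc n)"])
      fix m :: nat
      show "\<exists>N. int N = int (Suc n) + int m * int CARD('p) \<and>
          jet (to_fract (padic_gamma_nat N :: 'p padic_int)) ((- 1) ^ Suc n * fact n) (of_nat m * (g + hsum n))"
        using padic_gamma_nat_jet_pos[OF g(2) *(3), of m]
        by (intro exI[of _ "Suc n + m * CARD('p)"]) simp
    qed (use * g in auto)
  next
    fix q n and y :: "'p padic"
    assume *: "of_rat q = - of_nat n + padic_p * y" "y \<in> \<int>\<^sub>p" "n < CARD('p)"
    show "jet (padic_gamma_rat q) (1 / fact n) (y * (g + hsum n))"
    proof (rule padic_gamma_rat_jetI[OF odd, of q "- int n"])
      fix m :: nat
      assume m: "m > 0"
      then have "CARD('p) \<le> m * CARD('p)"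
        by simp
      then have "int (m * CARD('p) - n) = - int n + int m * int CARD('p)"
        using *(3) by (subst of_nat_diff) (linarith, simp)
      then show "\<exists>N. int N = - int n + int m * int CARD('p) \<and>
          jet (to_fract (padic_gamma_nat N :: 'p padic_int)) (1 / fact n) (of_nat m * (g + hsum n))"
        using padic_gamma_nat_jet_neg[OF g(2) *(3) m] by blast
    qed (use * g in auto)
  qed
qed

section \<open>A partial fraction identity\<close>

definition pf_ratio :: "nat \<Rightarrow> 'a :: field_char_0 \<Rightarrow> 'a" where
  "pf_ratio r x = (\<Prod>i = 1..r. (x + of_nat i) / (x - of_nat i))"

text \<open>For \<open>1 <= i <= r\<close> this is the residue of \<open>pf_ratio r\<close> at its
  simple pole \<open>i\<close>, in factorial form.\<close>

definition pf_coeff :: "nat \<Rightarrow> nat \<Rightarrow> 'a :: field_char_0" where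
  "pf_coeff r i = (- 1) ^ (r + i) * fact (r + i) / (fact (r - i) * fact i * fact (i - 1))"

lemma pf_ratio_Suc:
  "pf_ratio (Suc r) x = pf_ratio r x * ((x + of_nat (Suc r)) / (x - of_nat (Suc r)))"
  by (simp add: pf_ratio_def)

lemma pf_ratio_of_nat:
  assumes "r < n"
  shows "pf_ratio r (of_nat n :: 'a :: field_char_0) =
    fact (n + r) * fact (n - 1 - r) / (fact n * fact (n - 1))"
  using assms
proof (induction r)
  case 0
  then show ?case by (simp add: pf_ratio_def)
next
  case (Suc r)
  have e: "n - 1 - r = Suc (n - 1 - Suc r)"
    using Suc.prems by simp
  have 1: "(of_nat n - of_nat (Suc r) :: 'a) = of_nat (Suc (n - 1 - Suc r))"
    unfolding e[symmetric] using Suc.prems by (simp add: of_nat_diff)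
  have 2: "(of_nat n + of_nat (Suc r) :: 'a) = of_nat (Suc (n + r))"
    by simp
  have 3: "(of_nat (Suc (n - 1 - Suc r)) :: 'a) \<noteq> 0"
    by (simp only: of_nat_eq_0_iff)
  have "pf_ratio (Suc r) (of_nat n :: 'a) =
      fact (n + r) * (of_nat (Suc (n - 1 - Suc r)) * fact (n - 1 - Suc r)) / (fact n * fact (n - 1)) *
      (of_nat (Suc (n + r)) / of_nat (Suc (n - 1 - Suc r)))"
    unfolding pf_ratio_Suc 1 2 using Suc e by (simp del: of_nat_Suc)
  also have "\<dots> = (of_nat (Suc (n + r)) * fact (n + r)) * fact (n - 1 - Suc r) / (fact n * fact (n - 1))"
    using 3 by (simp del: of_nat_Suc)
  finally show ?case
    by simp
qed

text \<open>The residue at an old pole is multiplied by the value at \<open>i\<close> of the new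
  factor \<open>(x + m)/(x - m)\<close>, where \<open>m = r + 1\<close>. That value is written as
  \<open>1 - 2m/(m - i)\<close>, the form in which it arises in the partial fraction
  induction.\<close>

lemma pf_coeff_Suc:
  assumes "1 \<le> i" "i \<le> r"
  shows "(pf_coeff (Suc r) i :: 'a :: field_char_0) =
    pf_coeff r i - pf_coeff r i * (2 * of_nat (Suc r)) / (of_nat (Suc r) - of_nat i)"
proof -
  have 1: "(of_nat (Suc r) - of_nat i :: 'a) = of_nat (Suc (r - i))"
    using assms by (simp add: of_nat_diff)
  have 2: "(of_nat (Suc r) - of_nat i - 2 * of_nat (Suc r) :: 'a) = - of_nat (Suc (r + i))"
    by (simp add: algebra_simps)
  define u v :: 'a where "u = of_nat (Suc (r - i))" and "v = of_nat (Suc (r + i))"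
  have u: "u \<noteq> 0"
    unfolding u_def by (simp only: of_nat_eq_0_iff)
  define w :: 'a where "w = of_nat (Suc r)"
  have w: "u - 2 * w = - v"
    using 1 2 by (simp add: u_def v_def w_def)
  have "(pf_coeff (Suc r) i :: 'a) = pf_coeff r i * (- v / u)"
    using assms by (simp add: pf_coeff_def Suc_diff_le u_def v_def field_simps)
  also have "\<dots> = pf_coeff r i - pf_coeff r i * (2 * w) / u"
    unfolding w[symmetric] using u by (simp add: field_simps)
  finally show ?thesis
    unfolding 1 by (simp add: u_def w_def)
qed

text \<open>The residue at the new pole \<open>m = r + 1\<close>: the new factor has residue
  \<open>2m\<close> there, and the old factors contribute their value at \<open>m\<close>.\<close>

lemma pf_coeff_diag:
  "(pf_coeff (Suc r) (Suc r) :: 'a :: field_char_0) = 2 * of_nat (Suc r) * pf_ratio r (of_nat (Suc r))"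
proof -
  have "(pf_coeff (Suc r) (Suc r) :: 'a) = fact (Suc (Suc r + r)) / (fact (Suc r) * fact r)"
    by (simp add: pf_coeff_def)
  also have "\<dots> = of_nat (2 * Suc r) * fact (Suc r + r) / (fact (Suc r) * fact r)"
    by (simp only: fact_Suc) (simp add: algebra_simps)
  also have "\<dots> = 2 * of_nat (Suc r) * pf_ratio r (of_nat (Suc r))"
    by (subst pf_ratio_of_nat) simp_all
  finally show ?thesis .
qed

text \<open>Induction on \<open>r\<close>, multiplying by \<open>1 + 2m/(x - m)\<close> with
  \<open>m = r + 1\<close>. Splitting each product of two simple poles changes the old residues as
  in \<open>pf_coeff_Suc\<close> and gathers \<open>2m\<close> times the expansion at
  \<open>m\<close> on the new pole. The hypothesis is therefore needed at \<open>m\<close> as well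
  as at \<open>x\<close>, which is why \<open>x\<close> is arbitrary.\<close>

lemma pf_ratio_partial_fraction:
  fixes x :: "'a :: field_char_0"
  assumes "\<And>i. i \<in> {1..r} \<Longrightarrow> x \<noteq> of_nat i"
  shows "pf_ratio r x = 1 + (\<Sum>i = 1..r. pf_coeff r i / (x - of_nat i))"
  using assms
proof (induction r arbitrary: x)
  case 0
  then show ?case by (simp add: pf_ratio_def)
next
  case (Suc r)
  define m :: 'a where "m = of_nat (Suc r)"
  define c :: "nat \<Rightarrow> 'a" where "c = pf_coeff r"
  have xm: "x - m \<noteq> 0"
    using Suc.prems[of "Suc r"] by (simp add: m_def)
  have IHx: "pf_ratio r x = 1 + (\<Sum>i = 1..r. c i / (x - of_nat i))"
    using Suc by (simp add: c_def)
  have IHm: "pf_ratio r m = 1 + (\<Sum>i = 1..r. c i / (m - of_nat i))"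
    unfolding c_def m_def by (rule Suc.IH) (auto simp del: of_nat_Suc)
  have split: "c i / (x - of_nat i) * (2 * m / (x - m)) =
      2 * m / (x - m) * (c i / (m - of_nat i)) - c i * (2 * m) / (m - of_nat i) / (x - of_nat i)"
    if "i \<in> {1..r}" for i
  proof -
    define a where "a = x - of_nat i"
    define b where "b = m - of_nat i"
    have "a \<noteq> 0" "b \<noteq> 0" "x - m = a - b"
      using that Suc.prems[of i] by (auto simp: a_def b_def m_def simp del: of_nat_Suc)
    moreover have "a - b \<noteq> 0"
      using xm calculation(3) by simp
    ultimately show ?thesis
      unfolding a_def[symmetric] b_def[symmetric] by (simp add: divide_simps) (simp add: algebra_simps)
  qed
  have "pf_ratio (Suc r) x = pf_ratio r x * (1 + 2 * m / (x - m))"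
    unfolding pf_ratio_Suc m_def[symmetric] using xm by (simp add: field_simps)
  also have "\<dots> = pf_ratio r x + (1 + (\<Sum>i = 1..r. c i / (x - of_nat i))) * (2 * m / (x - m))"
    unfolding IHx by (simp add: algebra_simps)
  also have "\<dots> = pf_ratio r x + 2 * m / (x - m) + (\<Sum>i = 1..r. c i / (x - of_nat i) * (2 * m / (x - m)))"
    by (simp only: distrib_right sum_distrib_right mult_1_left add.assoc)
  also have "(\<Sum>i = 1..r. c i / (x - of_nat i) * (2 * m / (x - m))) =
     2 * m / (x - m) * (\<Sum>i = 1..r. c i / (m - of_nat i)) -
     (\<Sum>i = 1..r. c i * (2 * m) / (m - of_nat i) / (x - of_nat i))"
    unfolding sum_distrib_left sum_subtractf[symmetric] by (rule sum.cong) (use split in auto)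
  also have "pf_ratio r x + 2 * m / (x - m) + \<dots> =
     1 + ((\<Sum>i = 1..r. c i / (x - of_nat i)) - (\<Sum>i = 1..r. c i * (2 * m) / (m - of_nat i) / (x - of_nat i))) +
     2 * m * pf_ratio r m / (x - m)"
    unfolding IHx IHm by (simp add: algebra_simps add_divide_distrib)
  also have "(\<Sum>i = 1..r. c i / (x - of_nat i)) - (\<Sum>i = 1..r. c i * (2 * m) / (m - of_nat i) / (x - of_nat i)) =
     (\<Sum>i = 1..r. pf_coeff (Suc r) i / (x - of_nat i))"
    unfolding sum_subtractf[symmetric]
    by (rule sum.cong) (simp_all add: pf_coeff_Suc c_def m_def diff_divide_distrib del: of_nat_Suc)
  also have "2 * m * pf_ratio r m = pf_coeff (Suc r) (Suc r)"
    by (simp add: pf_coeff_diag m_def)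
  finally show ?case
    by (simp add: m_def)
qed

text \<open>The common value modulo \<open>p\<close> of the \<open>j\<close>-th terms of both sides of the congruence for \<open>j \<le> r\<close>.\<close>

definition hyp_coeff :: "nat \<Rightarrow> nat \<Rightarrow> 'a :: field_char_0" where
  "hyp_coeff r j = (- 1) ^ j * fact (r + j) / (fact (r - j) * fact j ^ 2)"

lemma pf_coeff_eq:
  assumes "i \<ge> 1"
  shows "(pf_coeff r i :: 'a :: field_char_0) = (- 1) ^ r * (of_nat i * hyp_coeff r i)"
proof -
  obtain k where "i = Suc k"
    using assms by (cases i) auto
  then show ?thesis
    by (simp add: pf_coeff_def hyp_coeff_def power_add power2_eq_square ac_simps del: of_nat_Suc)
qed

text \<open>The partial fraction expansion at \<open>0\<close>, where all \<open>r\<close> factors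
  of \<open>pf_ratio\<close> equal \<open>-1\<close>.\<close>

lemma sum_hyp_coeff: "(\<Sum>j = 0..r. hyp_coeff r j :: 'a :: field_char_0) = (- 1) ^ r"
proof -
  have "(\<Prod>i = 1..r. (0 + of_nat i) / (0 - of_nat i) :: 'a) = (\<Prod>i = 1..r. - 1)"
    by (rule prod.cong) auto
  then have "(- 1) ^ r = pf_ratio r (0 :: 'a)"
    by (simp add: pf_ratio_def)
  also have "\<dots> = 1 + (\<Sum>i = 1..r. pf_coeff r i / (0 - of_nat i))"
    by (rule pf_ratio_partial_fraction) auto
  also have "(\<Sum>i = 1..r. pf_coeff r i / (0 - of_nat i) :: 'a) = (\<Sum>i = 1..r. - ((- 1) ^ r * hyp_coeff r i))"
    by (rule sum.cong) (auto simp: pf_coeff_eq)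
  finally have "(- 1) ^ r = 1 - (- 1) ^ r * (\<Sum>i = 1..r. hyp_coeff r i :: 'a)"
    by (simp add: sum_negf sum_distrib_left)
  then have "(- 1) ^ r * (- 1) ^ r = (- 1) ^ r * (1 - (- 1) ^ r * (\<Sum>i = 1..r. hyp_coeff r i :: 'a))"
    by simp
  then have "1 = (- 1) ^ r - (\<Sum>i = 1..r. hyp_coeff r i :: 'a)"
    by (simp add: right_diff_distrib flip: power_mult_distrib mult.assoc)
  moreover have "(\<Sum>j = 0..r. hyp_coeff r j :: 'a) = 1 + (\<Sum>i = 1..r. hyp_coeff r i)"
    by (simp add: sum.atLeast_Suc_atMost hyp_coeff_def)
  ultimately show ?thesis
    by (simp add: eq_diff_eq)
qed

lemma hsum_diff: "hsum (n + j) - hsum j = (\<Sum>l = 1..n. 1 / (of_nat j + of_nat l) :: 'a :: field_char_0)"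
  by (induction n) (simp_all add: hsum_Suc algebra_simps)

text \<open>Since \<open>pf_ratio r\<close> vanishes at \<open>-l\<close> for
  \<open>1 <= l <= r\<close>, the expansion there says that the fractions
  \<open>pf_coeff r i / (i + l)\<close> sum to \<open>1\<close>. Summation over \<open>l\<close>
  turns \<open>1/(i + l)\<close> into \<open>H_{r+i} - H_i\<close> and the right-hand side into
  \<open>r\<close>.\<close>

lemma sum_hyp_coeff_hsum:
  "(\<Sum>j = 0..r. of_nat j * hyp_coeff r j * (hsum (r + j) - hsum j) :: 'a :: field_char_0) = (- 1) ^ r * of_nat r"
proof -
  have one: "(\<Sum>i = 1..r. pf_coeff r i / (of_nat i + of_nat l)) = (1 :: 'a)" if "l \<in> {1..r}" for l
  proof -
    have "- of_nat l \<noteq> (of_nat i :: 'a)" if "i \<in> {1..r}" for i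
    proof
      assume "- of_nat l = (of_nat i :: 'a)"
      then have "of_nat (i + l) = (0 :: 'a)"
        by (simp add: neg_eq_iff_add_eq_0 add.commute)
      then show False
        using that by (simp only: of_nat_eq_0_iff) simp
    qed
    then have "pf_ratio r (- of_nat l :: 'a) = 1 + (\<Sum>i = 1..r. pf_coeff r i / (- of_nat l - of_nat i))"
      by (rule pf_ratio_partial_fraction)
    moreover have "pf_ratio r (- of_nat l :: 'a) = 0"
      unfolding pf_ratio_def using that by (intro prod_zero) auto
    moreover have "(\<Sum>i = 1..r. pf_coeff r i / (- of_nat l - of_nat i) :: 'a) =
        - (\<Sum>i = 1..r. pf_coeff r i / (of_nat i + of_nat l))"
      unfolding sum_negf[symmetric]
    proof (rule sum.cong)
      fix i
      have "- of_nat l - of_nat i = - (of_nat i + of_nat l :: 'a)"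
        by simp
      then show "pf_coeff r i / (- of_nat l - of_nat i) = - (pf_coeff r i / (of_nat i + of_nat l) :: 'a)"
        by (metis divide_minus_right)
    qed simp
    ultimately show ?thesis
      by simp
  qed
  have "(\<Sum>j = 0..r. of_nat j * hyp_coeff r j * (hsum (r + j) - hsum j) :: 'a) =
      (\<Sum>j = 1..r. of_nat j * hyp_coeff r j * (hsum (r + j) - hsum j))"
    by (simp add: sum.atLeast_Suc_atMost)
  also have "\<dots> = (\<Sum>j = 1..r. (- 1) ^ r * (\<Sum>l = 1..r. pf_coeff r j / (of_nat j + of_nat l)))"
    by (rule sum.cong)
      (auto simp: hsum_diff pf_coeff_eq sum_distrib_left simp flip: power_mult_distrib mult.assoc)
  also have "\<dots> = (- 1) ^ r * (\<Sum>l = 1..r. \<Sum>j = 1..r. pf_coeff r j / (of_nat j + of_nat l))"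
    unfolding sum_distrib_left[symmetric] by (subst sum.swap) simp
  also have "(\<Sum>l = 1..r. \<Sum>j = 1..r. pf_coeff r j / (of_nat j + of_nat l) :: 'a) = (\<Sum>l = 1..r. 1)"
    by (rule sum.cong) (use one in auto)
  finally show ?thesis
    by simp
qed

text \<open>In the summed expansion the constant terms give \<open>n - r\<close>, and for fixed
  \<open>i\<close> the reciprocals \<open>1/(j - i)\<close> add up to a difference of harmonic
  numbers.\<close>

lemma sum_pf_ratio:
  assumes "r \<le> n"
  shows "(\<Sum>j = Suc r..n. pf_ratio r (of_nat j) :: 'a :: field_char_0) =
     of_nat (n - r) + (\<Sum>i = 1..r. pf_coeff r i * (hsum (n - i) - hsum (r - i)))"
  using assms
proof (induction n rule: dec_induct)
  case base
  then show ?case by simp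
next
  case (step n)
  have "pf_ratio r (of_nat (Suc n) :: 'a) = 1 + (\<Sum>i = 1..r. pf_coeff r i / (of_nat (Suc n) - of_nat i))"
    by (rule pf_ratio_partial_fraction) (use step in \<open>auto simp del: of_nat_Suc\<close>)
  also have "(\<Sum>i = 1..r. pf_coeff r i / (of_nat (Suc n) - of_nat i) :: 'a) =
      (\<Sum>i = 1..r. pf_coeff r i * (hsum (Suc n - i) - hsum (n - i)))"
  proof (rule sum.cong)
    fix i assume "i \<in> {1..r}"
    then have "Suc n - i = Suc (n - i)" "(of_nat (Suc n) - of_nat i :: 'a) = of_nat (Suc n - i)"
      using step by (auto simp: of_nat_diff)
    then show "pf_coeff r i / (of_nat (Suc n) - of_nat i) = (pf_coeff r i * (hsum (Suc n - i) - hsum (n - i)) :: 'a)"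
      by (simp add: hsum_Suc del: of_nat_Suc)
  qed simp
  finally have "pf_ratio r (of_nat (Suc n) :: 'a) = 1 + (\<Sum>i = 1..r. pf_coeff r i * (hsum (Suc n - i) - hsum (n - i)))" .
  moreover have "(\<Sum>i = 1..r. pf_coeff r i * (hsum (Suc n - i) - hsum (r - i)) :: 'a) =
      (\<Sum>i = 1..r. pf_coeff r i * (hsum (n - i) - hsum (r - i))) + (\<Sum>i = 1..r. pf_coeff r i * (hsum (Suc n - i) - hsum (n - i)))"
    by (simp add: algebra_simps flip: sum.distrib)
  moreover have "(\<Sum>j = Suc r..Suc n. pf_ratio r (of_nat j) :: 'a) =
      (\<Sum>j = Suc r..n. pf_ratio r (of_nat j)) + pf_ratio r (of_nat (Suc n))"
    using step by (simp del: of_nat_Suc)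
  moreover have "Suc n - r = Suc (n - r)"
    using step by simp
  ultimately show ?case
    using step by (simp only: of_nat_Suc) (simp add: algebra_simps)
qed

section \<open>The terms of the truncated hypergeometric series\<close>

definition padic_ideal :: "nat \<Rightarrow> 'p :: prime_card padic set" where
  "padic_ideal k = (\<lambda>z. padic_p ^ k * z) ` \<int>\<^sub>p"

lemma padic_idealI: "x = padic_p ^ k * z \<Longrightarrow> z \<in> \<int>\<^sub>p \<Longrightarrow> x \<in> padic_ideal k"
  by (auto simp: padic_ideal_def)

lemma padic_idealE:
  assumes "x \<in> padic_ideal k"
  obtains z where "z \<in> \<int>\<^sub>p" "x = padic_p ^ k * z"
  using assms by (auto simp: padic_ideal_def)

lemma padic_ideal_0 [simp]: "0 \<in> padic_ideal k"
  by (rule padic_idealI[of _ _ 0]) auto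

lemma padic_ideal_add:
  assumes "x \<in> padic_ideal k" "y \<in> padic_ideal k"
  shows "x + y \<in> padic_ideal k"
proof -
  obtain z w where "z \<in> \<int>\<^sub>p" "x = padic_p ^ k * z" "w \<in> \<int>\<^sub>p" "y = padic_p ^ k * w"
    using assms by (meson padic_idealE)
  then show ?thesis
    by (intro padic_idealI[of _ _ "z + w"]) (auto simp: distrib_left)
qed

lemma padic_ideal_diff:
  assumes "x \<in> padic_ideal k" "y \<in> padic_ideal k"
  shows "x - y \<in> padic_ideal k"
proof -
  obtain z w where "z \<in> \<int>\<^sub>p" "x = padic_p ^ k * z" "w \<in> \<int>\<^sub>p" "y = padic_p ^ k * w"
    using assms by (meson padic_idealE)
  then show ?thesis
    by (intro padic_idealI[of _ _ "z - w"]) (auto simp: right_diff_distrib)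
qed

lemma padic_ideal_mult: "x \<in> padic_ideal k \<Longrightarrow> y \<in> padic_ideal l \<Longrightarrow> x * y \<in> padic_ideal (k + l)"
proof (elim padic_idealE)
  fix z w :: "'a padic" assume "z \<in> \<int>\<^sub>p" "w \<in> \<int>\<^sub>p" "x = padic_p ^ k * z" "y = padic_p ^ l * w"
  then show ?thesis
    by (intro padic_idealI[of _ _ "z * w"]) (auto simp: power_add)
qed

lemma Zp_iff_padic_ideal: "x \<in> \<int>\<^sub>p \<longleftrightarrow> x \<in> padic_ideal 0"
  by (auto simp: padic_ideal_def)

lemma padic_ideal_mult_Zp: "x \<in> padic_ideal k \<Longrightarrow> y \<in> \<int>\<^sub>p \<Longrightarrow> x * y \<in> padic_ideal k"
  using padic_ideal_mult[of x k y 0] by (simp add: Zp_iff_padic_ideal)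

lemma padic_ideal_mult_Zp': "x \<in> \<int>\<^sub>p \<Longrightarrow> y \<in> padic_ideal k \<Longrightarrow> x * y \<in> padic_ideal k"
  by (metis padic_ideal_mult_Zp mult.commute)

lemma padic_p_mult_ideal: "x \<in> padic_ideal k \<Longrightarrow> padic_p * x \<in> padic_ideal (Suc k)"
  by (elim padic_idealE, rule padic_idealI) (auto simp: ac_simps)

lemma padic_ideal_sum: "(\<And>i. i \<in> A \<Longrightarrow> f i \<in> padic_ideal k) \<Longrightarrow> sum f A \<in> padic_ideal k"
  by (induction A rule: infinite_finite_induct) (auto intro: padic_ideal_add)

lemma padic_ideal_Zp: "x \<in> padic_ideal k \<Longrightarrow> x \<in> \<int>\<^sub>p"
  by (elim padic_idealE) auto

lemma jet_diff_ideal: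
  assumes "jet x u a" "jet y u b"
  shows "x - y - padic_p * (u * (a - b)) \<in> padic_ideal 2"
proof -
  obtain z w where "z \<in> \<int>\<^sub>p" "w \<in> \<int>\<^sub>p"
    and zw: "x = u * (1 + padic_p * a + padic_p ^ 2 * z)" "y = u * (1 + padic_p * b + padic_p ^ 2 * w)"
    using assms by (auto simp: jet_def)
  then show ?thesis
    using assms by (intro padic_idealI[of _ _ "u * (z - w)"])
      (auto simp: jet_def padic_unitsD algebra_simps)
qed

lemma jet_diff_ideal_1: "jet x u a \<Longrightarrow> x - u \<in> padic_ideal 1"
  by (elim jet_mod_p) (auto intro: padic_idealI)

lemma Zp_fact [simp]: "(fact n :: 'p :: prime_card padic) \<in> \<int>\<^sub>p"
  using Zp_of_nat[of "fact n"] by simp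

lemma fact_padic_ideal: "n \<ge> CARD('p) \<Longrightarrow> (fact n :: 'p :: prime_card padic) \<in> padic_ideal 1"
proof -
  assume "n \<ge> CARD('p)"
  then have "CARD('p) dvd fact n"
    by (intro dvd_fact) (auto simp: prime_gt_0_nat[OF prime_card] Suc_leI)
  then obtain k where "fact n = CARD('p) * k"
    by (auto simp: dvd_def)
  then have "(of_nat (fact n) :: 'p padic) = padic_p * of_nat k"
    by (simp add: padic_p_def)
  then show ?thesis
    by (intro padic_idealI[of _ _ "of_nat k"]) auto
qed

lemma hyp_coeff_Zp:
  assumes "2 * r < CARD('p)" "j \<le> r"
  shows "(hyp_coeff r j :: 'p :: prime_card padic) \<in> \<int>\<^sub>p"
  unfolding hyp_coeff_def using assms
  by (intro Zp_divide Zp_mult padic_units_mult padic_units_power padic_units_fact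
      padic_unitsD(1)[OF padic_units_fact] Zp_power) auto

text \<open>The three evaluations of the partial fraction expansion show that the expression is
  exactly \<open>(-1)^r p + X - (-1)^r Y\<close>. Here \<open>X\<close> is divisible by
  \<open>p\<close> because of \<open>hsum_reflect\<close>, and \<open>Y\<close> because for
  \<open>p - r <= j < p\<close> the numerator \<open>(j + r)!\<close> of \<open>R j\<close> contains
  \<open>p\<close> while its denominator is a unit.\<close>

lemma harmonic_sum_congruence:
  assumes odd: "odd CARD('p :: prime_card)" and r: "2 * r < CARD('p)"
  shows "(\<Sum>j = 0..r. hyp_coeff r j * (1 + of_nat j * (hsum (r - j) + hsum (r + j) - 2 * hsum j))) +
    (- 1) ^ r * (\<Sum>j = Suc r..CARD('p) - 1 - r. pf_ratio r (of_nat j)) \<in> (padic_ideal 1 :: 'p padic set)"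
proof -
  let ?p = "CARD('p)"
  let ?w = "\<lambda>j. hyp_coeff r j :: 'p padic"
  let ?R = "\<lambda>j. pf_ratio r (of_nat j) :: 'p padic"
  let ?H = "hsum :: nat \<Rightarrow> 'p padic"
  define X where "X = (\<Sum>j = 0..r. of_nat j * ?w j * (?H (?p - 1 - j) - ?H j))"
  define Y where "Y = (\<Sum>j = ?p - r..?p - 1. ?R j)"
  have "(- 1) ^ r * (\<Sum>j = Suc r..?p - 1. ?R j) =
      (- 1) ^ r * of_nat (?p - 1 - r) + (\<Sum>i = 1..r. of_nat i * ?w i * (?H (?p - 1 - i) - ?H (r - i)))"
  proof -
    have "(\<Sum>i = 1..r. pf_coeff r i * (?H (?p - 1 - i) - ?H (r - i))) =
        (- 1) ^ r * (\<Sum>i = 1..r. of_nat i * ?w i * (?H (?p - 1 - i) - ?H (r - i)))"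
      unfolding sum_distrib_left by (rule sum.cong) (auto simp: pf_coeff_eq mult.assoc)
    then show ?thesis
      using r by (subst sum_pf_ratio) (auto simp: distrib_left simp flip: power_mult_distrib mult.assoc)
  qed
  also have "(\<Sum>i = 1..r. of_nat i * ?w i * (?H (?p - 1 - i) - ?H (r - i))) =
      (\<Sum>i = 0..r. of_nat i * ?w i * (?H (?p - 1 - i) - ?H (r - i)))"
    by (simp add: sum.atLeast_Suc_atMost)
  also have "of_nat (?p - 1 - r) = padic_p - 1 - (of_nat r :: 'p padic)"
    using r by (simp add: padic_p_def of_nat_diff)
  finally have 1: "(- 1) ^ r * (\<Sum>j = Suc r..?p - 1. ?R j) = (- 1) ^ r * (padic_p - 1 - of_nat r) +
      (\<Sum>i = 0..r. of_nat i * ?w i * (?H (?p - 1 - i) - ?H (r - i)))" .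
  have "{Suc r..?p - 1} = {Suc r..?p - 1 - r} \<union> {?p - r..?p - 1}"
    using r by auto
  then have 2: "(\<Sum>j = Suc r..?p - 1. ?R j) = (\<Sum>j = Suc r..?p - 1 - r. ?R j) + Y"
    unfolding Y_def using r by (subst sum.union_disjoint[symmetric]) auto
  \<comment> \<open>\<open>H_{p-1-j}\<close> is added and subtracted so that the sum occurring in
    \<open>1\<close> appears and cancels; the price is the reflection error
    \<open>X\<close>.\<close>
  have 3: "(\<Sum>j = 0..r. ?w j * (1 + of_nat j * (?H (r - j) + ?H (r + j) - 2 * ?H j))) =
      (\<Sum>j = 0..r. ?w j) + (\<Sum>j = 0..r. of_nat j * ?w j * (?H (r + j) - ?H j)) + X -
      (\<Sum>j = 0..r. of_nat j * ?w j * (?H (?p - 1 - j) - ?H (r - j)))"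
    unfolding X_def by (simp only: sum.distrib[symmetric] sum_subtractf[symmetric]) (simp add: algebra_simps)
  have "(\<Sum>j = 0..r. ?w j * (1 + of_nat j * (?H (r - j) + ?H (r + j) - 2 * ?H j))) +
      (- 1) ^ r * (\<Sum>j = Suc r..?p - 1 - r. ?R j) =
      (\<Sum>j = 0..r. ?w j * (1 + of_nat j * (?H (r - j) + ?H (r + j) - 2 * ?H j))) +
      (- 1) ^ r * (\<Sum>j = Suc r..?p - 1. ?R j) - (- 1) ^ r * Y"
    unfolding 2 by (simp add: algebra_simps)
  also have "\<dots> = (- 1) ^ r * padic_p + X - (- 1) ^ r * Y"
    unfolding 1 3 sum_hyp_coeff sum_hyp_coeff_hsum by (simp add: algebra_simps)
  also have "\<dots> \<in> padic_ideal 1"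
  proof (intro padic_ideal_diff padic_ideal_add padic_ideal_mult_Zp')
    show "padic_p \<in> (padic_ideal 1 :: 'p padic set)"
      by (rule padic_idealI[of _ _ 1]) auto
    show "X \<in> padic_ideal 1"
      unfolding X_def
    proof (intro padic_ideal_sum padic_ideal_mult_Zp')
      fix j assume j: "j \<in> {0..r}"
      show "of_nat j * ?w j \<in> \<int>\<^sub>p"
        using hyp_coeff_Zp[OF r] j by auto
      show "?H (?p - 1 - j) - ?H j \<in> padic_ideal 1"
        using hsum_reflect[OF odd, of j] j r by (auto intro: padic_idealI)
    qed
    show "Y \<in> padic_ideal 1"
      unfolding Y_def
    proof (rule padic_ideal_sum)
      fix j assume j: "j \<in> {?p - r..?p - 1}"
      have "?R j = fact (j + r) * (fact (j - 1 - r) / (fact j * fact (j - 1)))"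
        using j r by (subst pf_ratio_of_nat) auto
      also have "\<dots> \<in> padic_ideal 1"
        using j r by (intro padic_ideal_mult_Zp fact_padic_ideal Zp_divide padic_units_mult padic_units_fact
            padic_unitsD(1)[OF padic_units_fact]) auto
      finally show "?R j \<in> padic_ideal 1" .
    qed
  qed auto
  finally show ?thesis .
qed

section \<open>Expansions of the hypergeometric summands for head, middle and tail indices\<close>

definition hyp_term :: "'a :: field_char_0 \<Rightarrow> nat \<Rightarrow> 'a" where
  "hyp_term b j = pochhammer b j * pochhammer (1 - b) j / fact j ^ 2"

context
  fixes r :: nat and a b :: "'p :: prime_card padic"
  assumes r: "2 * r < CARD('p)" and a: "a \<in> \<int>\<^sub>p" and b: "b = - of_nat r + padic_p * a"
begin

text \<open>For \<open>i < r\<close> the factor \<open>b + i = -(r - i) + p a\<close> has a unit as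
  leading term and slope \<open>-a/(r - i)\<close>.\<close>

lemma pochhammer_jet_left:
  assumes "k \<le> r"
  shows "jet (pochhammer b k) ((- 1) ^ k * fact r / fact (r - k)) (- a * (hsum r - hsum (r - k)))"
  using assms
proof (induction k)
  case 0
  then show ?case by (simp add: jet_const)
next
  case (Suc k)
  let ?n = "r - Suc k"
  have e: "r - k = Suc ?n"
    using Suc.prems by simp
  have bk: "b + of_nat k = - of_nat (Suc ?n) + padic_p * a"
    unfolding b e[symmetric] using Suc.prems by (simp add: of_nat_diff)
  have u: "(of_nat (Suc ?n) :: 'p padic) \<in> padic_units"
    using r Suc.prems by (intro padic_units_of_nat') auto
  have "jet (pochhammer b k * (b + of_nat k)) ((- 1) ^ k * fact r / fact (r - k) * (- of_nat (Suc ?n)))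
      (- a * (hsum r - hsum (r - k)) + a / - of_nat (Suc ?n))"
    unfolding bk using Suc u a by (intro jet_mult jet_add) (auto simp del: of_nat_Suc)
  moreover have "(- 1) ^ k * fact r / fact (r - k) * (- of_nat (Suc ?n)) = (- 1) ^ Suc k * fact r / (fact ?n :: 'p padic)"
    unfolding e fact_Suc using padic_unitsD(2)[OF u] by (simp del: of_nat_Suc)
  moreover have "- a * (hsum r - hsum (r - k)) + a / - of_nat (Suc ?n) = - a * (hsum r - hsum ?n)"
    unfolding e hsum_Suc by (simp add: algebra_simps del: of_nat_Suc)
  ultimately show ?case
    by (simp only: pochhammer_Suc)
qed

lemma pochhammer_jet_right:
  assumes "r + k < CARD('p)"
  shows "jet (pochhammer (1 - b) k) (fact (r + k) / fact r) (- a * (hsum (r + k) - hsum r))"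
  using assms
proof (induction k)
  case 0
  then show ?case by (simp add: jet_const)
next
  case (Suc k)
  let ?n = "r + k"
  have bk: "1 - b + of_nat k = of_nat (Suc ?n) + padic_p * (- a)"
    unfolding b by simp
  have u: "(of_nat (Suc ?n) :: 'p padic) \<in> padic_units"
    using Suc.prems by (intro padic_units_of_nat') auto
  have "jet (pochhammer (1 - b) k * (1 - b + of_nat k)) (fact ?n / fact r * of_nat (Suc ?n))
      (- a * (hsum ?n - hsum r) + (- a) / of_nat (Suc ?n))"
    unfolding bk using Suc u a by (intro jet_mult jet_add) (auto simp del: of_nat_Suc)
  moreover have "fact ?n / fact r * of_nat (Suc ?n) = (fact (Suc ?n) / fact r :: 'p padic)"
    unfolding fact_Suc by (simp del: of_nat_Suc)
  moreover have "- a * (hsum ?n - hsum r) + (- a) / of_nat (Suc ?n) = - a * (hsum (Suc ?n) - hsum r)"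
    unfolding hsum_Suc by (simp add: algebra_simps del: of_nat_Suc)
  ultimately show ?case
    by (simp only: pochhammer_Suc add_Suc_right)
qed

text \<open>The factor \<open>b + r\<close> is exactly \<open>p a\<close>. Modulo \<open>p\<close>
  the factors before it multiply to \<open>(-1)^r r!\<close> and those after it to
  \<open>k!\<close>. With \<open>p a\<close> split off, the cofactor has to be followed only modulo
  \<open>p\<close>, and \<open>k\<close> needs no bound.\<close>

lemma pochhammer_mid_left:
  "pochhammer b (Suc r + k) - padic_p * a * ((- 1) ^ r * fact r * fact k) \<in> padic_ideal 2"
proof -
  have "\<exists>z\<in>\<int>\<^sub>p. pochhammer b (Suc r + k) = padic_p * a * ((- 1) ^ r * fact r * fact k + padic_p * z)"
  proof (induction k)
    case 0
    obtain z where z: "z \<in> \<int>\<^sub>p" "pochhammer b r = (- 1) ^ r * fact r + padic_p * z"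
      using jet_mod_p[OF pochhammer_jet_left[OF order.refl]] by auto
    have "b + of_nat r = padic_p * a"
      by (simp add: b)
    then have "pochhammer b (Suc r) = padic_p * a * ((- 1) ^ r * fact r + padic_p * z)"
      by (simp add: pochhammer_Suc z)
    then show ?case
      using z by auto
  next
    case (Suc k)
    then obtain z where z: "z \<in> \<int>\<^sub>p"
      "pochhammer b (Suc r + k) = padic_p * a * ((- 1) ^ r * fact r * fact k + padic_p * z)"
      by blast
    have bk: "b + of_nat (Suc r + k) = of_nat (Suc k) + padic_p * a"
      by (simp add: b)
    have "pochhammer b (Suc (Suc r + k)) = pochhammer b (Suc r + k) * (b + of_nat (Suc r + k))"
      by (rule pochhammer_Suc)
    also have "\<dots> = padic_p * a * ((- 1) ^ r * fact r * fact (Suc k) +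
        padic_p * ((- 1) ^ r * fact r * fact k * a + z * (of_nat (Suc k) + padic_p * a)))"
      unfolding bk z(2) fact_Suc by (simp add: algebra_simps)
    finally show ?case
      using z a by (intro bexI[of _ "(- 1) ^ r * fact r * fact k * a + z * (of_nat (Suc k) + padic_p * a)"])
        (auto simp del: of_nat_Suc)
  qed
  then obtain z where z: "z \<in> \<int>\<^sub>p"
    "pochhammer b (Suc r + k) = padic_p * a * ((- 1) ^ r * fact r * fact k + padic_p * z)" ..
  show ?thesis
    unfolding z(2) using z(1) a
    by (intro padic_idealI[of _ _ "a * z"]) (auto simp: algebra_simps power2_eq_square)
qed

text \<open>Holds for every \<open>k\<close>: once \<open>r + k >= p\<close> it shows that the
  Pochhammer symbol itself is divisible by \<open>p\<close>, which is how the tail uses it.\<close>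

lemma pochhammer_mid_right:
  "pochhammer (1 - b) k - fact (r + k) / fact r \<in> padic_ideal 1"
proof (induction k)
  case 0
  then show ?case by simp
next
  case (Suc k)
  have bk: "1 - b + of_nat k = of_nat (Suc (r + k)) - padic_p * a"
    unfolding b by simp
  have P: "pochhammer (1 - b) k \<in> \<int>\<^sub>p"
  proof -
    have "(fact (r + k) / fact r :: 'p padic) \<in> \<int>\<^sub>p"
      using r by (intro Zp_divide) auto
    then show ?thesis
      using Zp_add[OF padic_ideal_Zp[OF Suc], of "fact (r + k) / fact r"] by simp
  qed
  have "pochhammer (1 - b) (Suc k) - fact (r + Suc k) / fact r =
     (pochhammer (1 - b) k - fact (r + k) / fact r) * of_nat (Suc (r + k)) - padic_p * (a * pochhammer (1 - b) k)"
    unfolding pochhammer_Suc bk by (simp add: algebra_simps)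
  also have "\<dots> \<in> padic_ideal 1"
    using a P by (intro padic_ideal_diff[OF padic_ideal_mult_Zp[OF Suc Zp_of_nat]]
        padic_idealI[of _ 1 "a * pochhammer (1 - b) k"]) auto
  finally show ?case .
qed

lemma hyp_term_head:
  assumes "j \<le> r"
  shows "jet (hyp_term b j) (hyp_coeff r j) (- a * (hsum (r + j) - hsum (r - j)))"
proof -
  have "jet (fact j ^ 2 :: 'p padic) (fact j ^ 2) 0"
    using assms r by (intro jet_const padic_units_power padic_units_fact) auto
  with pochhammer_jet_left[OF assms] pochhammer_jet_right[of j] assms r
  have "jet (hyp_term b j) ((- 1) ^ j * fact r / fact (r - j) * (fact (r + j) / fact r) / fact j ^ 2)
     (- a * (hsum r - hsum (r - j)) + - a * (hsum (r + j) - hsum r) - 0)"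
    unfolding hyp_term_def by (intro jet_divide jet_mult) auto
  then show ?thesis
    by (simp add: hyp_coeff_def algebra_simps)
qed

text \<open>With \<open>A\<close> divisible by \<open>p\<close>, the other Pochhammer symbol is
  needed only modulo \<open>p\<close>:
  \<open>u v - A B = (u - A) B + (u - A) (v - B) + A (v - B)\<close>, and each summand is divisible
  by \<open>p^2\<close>.\<close>

lemma hyp_term_mid:
  assumes "r < j" "j < CARD('p) - r"
  shows "hyp_term b j - padic_p * ((- 1) ^ r * a * (fact (j - Suc r) * fact (r + j) / fact j ^ 2)) \<in> padic_ideal 2"
proof -
  let ?A = "padic_p * a * ((- 1) ^ r * fact r * fact (j - Suc r))" and ?B = "fact (r + j) / fact r :: 'p padic"
  have 1: "pochhammer b j - ?A \<in> padic_ideal 2"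
    using pochhammer_mid_left[of "j - Suc r"] assms by simp
  have 2: "pochhammer (1 - b) j - ?B \<in> padic_ideal 1"
    by (rule pochhammer_mid_right)
  have B: "?B \<in> \<int>\<^sub>p"
    using assms r by (intro Zp_divide padic_unitsD(1)[OF padic_units_fact] padic_units_fact) auto
  have A: "?A \<in> padic_ideal 1"
    using assms a by (intro padic_idealI[of _ _ "a * ((- 1) ^ r * fact r * fact (j - Suc r))"])
      (auto simp: ac_simps)
  have pos: "(fact j ^ 2 :: 'p padic) \<in> padic_units"
    using assms by (intro padic_units_power padic_units_fact) auto
  have "?A * (pochhammer (1 - b) j - ?B) \<in> padic_ideal 2"
    using padic_ideal_mult[OF A 2] by (simp add: numeral_2_eq_2)
  note this padic_ideal_mult_Zp[OF 1 padic_ideal_Zp[OF 2]] padic_ideal_mult_Zp[OF 1 B]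
  then have "(pochhammer b j - ?A) * ?B + (pochhammer b j - ?A) * (pochhammer (1 - b) j - ?B) +
      ?A * (pochhammer (1 - b) j - ?B) \<in> padic_ideal 2"
    by (intro padic_ideal_add)
  then have "((pochhammer b j - ?A) * ?B + (pochhammer b j - ?A) * (pochhammer (1 - b) j - ?B) +
      ?A * (pochhammer (1 - b) j - ?B)) * (1 / fact j ^ 2) \<in> padic_ideal 2"
    by (rule padic_ideal_mult_Zp) (use pos in simp)
  also have "((pochhammer b j - ?A) * ?B + (pochhammer b j - ?A) * (pochhammer (1 - b) j - ?B) + ?A * (pochhammer (1 - b) j - ?B)) * (1 / fact j ^ 2)
     = hyp_term b j - ?A * ?B / fact j ^ 2"
    unfolding hyp_term_def by (simp add: algebra_simps diff_divide_distrib)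
  also have "?A * ?B / fact j ^ 2 = padic_p * ((- 1) ^ r * a * (fact (j - Suc r) * fact (r + j) / fact j ^ 2))"
    by (simp add: ac_simps)
  finally show ?thesis .
qed

text \<open>Each Pochhammer symbol supplies a factor \<open>p\<close>: the first contains
  \<open>b + r = p a\<close>, the second is congruent to \<open>(r + j)!/r!\<close> with
  \<open>r + j >= p\<close>.\<close>

lemma hyp_term_tail:
  assumes "CARD('p) - r \<le> j" "j < CARD('p)"
  shows "hyp_term b j \<in> padic_ideal 2"
proof -
  have "pochhammer b j \<in> padic_ideal 1"
  proof -
    have j: "Suc r + (j - Suc r) = j"
      using assms r by simp
    obtain z where z: "z \<in> \<int>\<^sub>p" "pochhammer b j - padic_p * a * ((- 1) ^ r * fact r * fact (j - Suc r)) = padic_p ^ 2 * z"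
      using pochhammer_mid_left[of "j - Suc r"] unfolding j by (rule padic_idealE)
    then have "pochhammer b j = padic_p ^ 1 * (a * ((- 1) ^ r * fact r * fact (j - Suc r)) + padic_p * z)"
      by (simp add: algebra_simps power2_eq_square)
    then show ?thesis
      by (rule padic_idealI) (use a z in auto)
  qed
  moreover have "pochhammer (1 - b) j \<in> padic_ideal 1"
  proof -
    have "(fact (r + j) / fact r :: 'p padic) \<in> padic_ideal 1"
      unfolding divide_inverse using assms r
      by (intro padic_ideal_mult_Zp fact_padic_ideal padic_unitsD(3) padic_units_fact) auto
    from padic_ideal_add[OF pochhammer_mid_right[of j] this] show ?thesis
      by simp
  qed
  ultimately have "pochhammer b j * pochhammer (1 - b) j * (1 / fact j ^ 2) \<in> padic_ideal (1 + 1)"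
    using assms by (intro padic_ideal_mult_Zp padic_ideal_mult Zp_divide padic_units_power padic_units_fact) auto
  then show ?thesis
    by (simp add: hyp_term_def numeral_2_eq_2)
qed

end

section \<open>The terms of the function G\<close>

text \<open>The terms of G enter as an abstract family \<open>f\<close>, so that one comparison
  serves both residue classes of \<open>p\<close> modulo \<open>d\<close>. In the head the parts of
  the slopes that contain \<open>a\<close> cancel; what is left over all ranges is \<open>p\<close>
  times the sum in \<open>harmonic_sum_congruence\<close>.\<close>

lemma hyp_term_sums_congruence:
  fixes a b :: "'p :: prime_card padic"
  assumes odd: "odd CARD('p)" and r: "2 * r < CARD('p)" and a: "a \<in> \<int>\<^sub>p"
    and b: "b = - of_nat r + padic_p * a"
    and head: "\<And>j. j \<le> r \<Longrightarrow> jet (f j) (hyp_coeff r j)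
      (1 + of_nat j * (hsum (r - j) + hsum (r + j) - 2 * hsum j) - a * (hsum (r + j) - hsum (r - j)))"
    and mid: "\<And>j. r < j \<Longrightarrow> j < CARD('p) - r \<Longrightarrow>
      f j - padic_p * ((- 1) ^ r * \<kappa> j * (fact (j - Suc r) * fact (r + j) / fact j ^ 2)) \<in> padic_ideal 2"
    and \<kappa>: "\<And>j. r < j \<Longrightarrow> j < CARD('p) - r \<Longrightarrow> \<kappa> j - a - of_nat j \<in> padic_ideal 1"
    and tail: "\<And>j. CARD('p) - r \<le> j \<Longrightarrow> j < CARD('p) \<Longrightarrow> f j \<in> padic_ideal 2"
  shows "(\<Sum>j = 0..CARD('p) - 1. f j) - (\<Sum>j = 0..CARD('p) - 1. hyp_term b j) \<in> padic_ideal 2"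
proof -
  let ?p = "CARD('p)"
  let ?w = "\<lambda>j. hyp_coeff r j * (1 + of_nat j * (hsum (r - j) + hsum (r + j) - 2 * hsum j)) :: 'p padic"
  let ?R = "\<lambda>j. pf_ratio r (of_nat j) :: 'p padic"
  define D where "D = (\<lambda>j. f j - hyp_term b j)"
  have 1: "D j - padic_p * ?w j \<in> padic_ideal 2" if "j \<le> r" for j
    using jet_diff_ideal[OF head[OF that] hyp_term_head[OF r a b that]] by (simp add: D_def)
  have 2: "D j - padic_p * ((- 1) ^ r * ?R j) \<in> padic_ideal 2" if j: "r < j" "j < ?p - r" for j
  proof -
    define M :: "'p padic" where "M = fact (j - Suc r) * fact (r + j) / fact j ^ 2"
    have M: "M \<in> \<int>\<^sub>p"
      unfolding M_def using j by (intro Zp_divide padic_units_power padic_units_fact) auto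
    obtain i where i: "j = Suc i"
      using j by (cases j) auto
    \<comment> \<open>The two middle terms differ by \<open>p (-1)^r (\<kappa> j - a) M\<close>
      modulo \<open>p^2\<close>. As \<open>\<kappa> j - a\<close> is congruent to \<open>j\<close>,
      the factor \<open>j M\<close> appears, which is the value of \<open>pf_ratio\<close>.\<close>
    have "?R j = of_nat j * M"
      unfolding M_def using j
      by (subst pf_ratio_of_nat) (auto simp: i power2_eq_square ac_simps simp del: of_nat_Suc)
    then have "D j - padic_p * ((- 1) ^ r * ?R j) =
        (f j - padic_p * ((- 1) ^ r * \<kappa> j * M)) - (hyp_term b j - padic_p * ((- 1) ^ r * a * M)) +
        padic_p * ((\<kappa> j - a - of_nat j) * ((- 1) ^ r * M))"
      by (simp add: D_def algebra_simps)
    also have "\<dots> \<in> padic_ideal 2"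
    proof (rule padic_ideal_add[OF padic_ideal_diff])
      show "padic_p * ((\<kappa> j - a - of_nat j) * ((- 1) ^ r * M)) \<in> padic_ideal 2"
        using padic_p_mult_ideal[OF padic_ideal_mult_Zp[OF \<kappa>[OF j], of "(- 1) ^ r * M"]] M
        by (simp add: numeral_2_eq_2)
    qed (use mid[OF j] hyp_term_mid[OF r a b j] in \<open>simp_all only: M_def\<close>)
    finally show ?thesis .
  qed
  have 3: "D j \<in> padic_ideal 2" if "j \<in> {?p - r..?p - 1}" for j
    unfolding D_def using that r by (intro padic_ideal_diff tail hyp_term_tail[OF r a b]) auto
  have "{0..?p - 1} = {0..r} \<union> {Suc r..?p - 1 - r} \<union> {?p - r..?p - 1}"
    using r by auto
  then have "(\<Sum>j = 0..?p - 1. D j) = sum D ({0..r} \<union> {Suc r..?p - 1 - r} \<union> {?p - r..?p - 1})"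
    by (rule arg_cong)
  also have "\<dots> = sum D ({0..r} \<union> {Suc r..?p - 1 - r}) + (\<Sum>j = ?p - r..?p - 1. D j)"
    using r by (intro sum.union_disjoint) auto
  also have "sum D ({0..r} \<union> {Suc r..?p - 1 - r}) = (\<Sum>j = 0..r. D j) + (\<Sum>j = Suc r..?p - 1 - r. D j)"
    by (intro sum.union_disjoint) auto
  also have "(\<Sum>j = 0..r. D j) + (\<Sum>j = Suc r..?p - 1 - r. D j) + (\<Sum>j = ?p - r..?p - 1. D j) =
      (\<Sum>j = 0..r. D j - padic_p * ?w j) + (\<Sum>j = Suc r..?p - 1 - r. D j - padic_p * ((- 1) ^ r * ?R j)) +
      (\<Sum>j = ?p - r..?p - 1. D j) +
      padic_p * ((\<Sum>j = 0..r. ?w j) + (- 1) ^ r * (\<Sum>j = Suc r..?p - 1 - r. ?R j))"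
    by (simp add: sum_subtractf sum_distrib_left distrib_left)
  also have "\<dots> \<in> padic_ideal 2"
  proof -
    have "padic_p * ((\<Sum>j = 0..r. ?w j) + (- 1) ^ r * (\<Sum>j = Suc r..?p - 1 - r. ?R j)) \<in> padic_ideal 2"
      using padic_p_mult_ideal[OF harmonic_sum_congruence[OF odd r]] by (simp add: numeral_2_eq_2)
    moreover have "(\<Sum>j = 0..r. D j - padic_p * ?w j) \<in> padic_ideal 2"
      by (rule padic_ideal_sum) (use 1 in auto)
    moreover have "(\<Sum>j = Suc r..?p - 1 - r. D j - padic_p * ((- 1) ^ r * ?R j)) \<in> padic_ideal 2"
      by (rule padic_ideal_sum) (use 2 in auto)
    moreover have "(\<Sum>j = ?p - r..?p - 1. D j) \<in> padic_ideal 2"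
      by (rule padic_ideal_sum) (use 3 in auto)
    ultimately show ?thesis
      by (intro padic_ideal_add)
  qed
  finally show ?thesis
    by (simp add: D_def sum_subtractf)
qed

lemma hyp_term_Zp:
  fixes a b :: "'p :: prime_card padic"
  assumes r: "2 * r < CARD('p)" and a: "a \<in> \<int>\<^sub>p" and b: "b = - of_nat r + padic_p * a" and j: "j < CARD('p)"
  shows "hyp_term b j \<in> \<int>\<^sub>p"
proof -
  have "pochhammer c k \<in> \<int>\<^sub>p" if "c \<in> \<int>\<^sub>p" for c :: "'p padic" and k
    using that by (induction k) (auto simp: pochhammer_Suc)
  then show ?thesis
    unfolding hyp_term_def using a j by (intro Zp_divide Zp_mult padic_units_power padic_units_fact) (auto simp: b)
qed

lemma hyp_term_reflect: "hyp_term (1 - b) j = hyp_term b j"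
  by (simp add: hyp_term_def mult.commute)

lemma of_rat_pochhammer: "of_rat (pochhammer q k) = pochhammer (of_rat q) k"
  by (induction k) (simp_all add: pochhammer_Suc of_rat_mult of_rat_add)

lemma of_rat_fact [simp]: "of_rat (fact k) = fact k"
  by (metis of_nat_fact of_rat_of_nat_eq)

lemma of_rat_truncated_hypergeometric:
  "of_rat (truncated_hypergeometric [q, 1 - q] [1] 1 n) = (\<Sum>k = 0..n. hyp_term (of_rat q) k)"
  unfolding truncated_hypergeometric_def of_rat_sum
  by (rule sum.cong)
    (simp_all add: hyp_term_def of_rat_mult of_rat_divide of_rat_pochhammer of_rat_diff
      pochhammer_fact[symmetric] power2_eq_square)

section \<open>The summands of G as products of gamma quotients\<close>

definition G_factor :: "rat \<Rightarrow> rat \<Rightarrow> 'p :: prime_card padic" where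
  "G_factor q x = padic_gamma_rat (frac (q - x)) / padic_gamma_rat q * (- padic_p) powi (- \<lfloor>q - x\<rfloor>)"

lemma G_factor_nonneg:
  assumes "x \<le> q" "q < 1" "0 \<le> x"
  shows "G_factor q x = padic_gamma_rat (q - x) / padic_gamma_rat q"
proof -
  have "\<lfloor>q - x\<rfloor> = 0"
    using assms by (simp add: floor_eq_iff)
  then show ?thesis
    by (simp add: G_factor_def frac_def)
qed

text \<open>The source of the powers of \<open>p\<close> in G: each argument \<open>q\<close> lying
  below \<open>x\<close> has floor \<open>-1\<close> and contributes one factor
  \<open>-p\<close>.\<close>

lemma G_factor_neg:
  assumes "q < x" "0 < q" "x < 1"
  shows "G_factor q x = padic_gamma_rat (q - x + 1) / padic_gamma_rat q * - padic_p"
proof -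
  have "\<lfloor>q - x\<rfloor> = - 1"
    using assms by (simp add: floor_eq_iff)
  then show ?thesis
    by (simp add: G_factor_def frac_def)
qed

text \<open>The type argument carries \<open>p\<close>, which cannot be recovered from the rational
  result.\<close>

definition G_arg :: "'p :: prime_card itself \<Rightarrow> nat \<Rightarrow> rat" where
  "G_arg _ j = of_nat j / (of_nat CARD('p) - 1)"

text \<open>With two arguments the sign \<open>(-1)^j\<close> is squared and disappears; the
  constant in front of the sum is moved into each summand.\<close>

definition G_term :: "rat \<Rightarrow> nat \<Rightarrow> 'p :: prime_card padic" where
  "(G_term q j :: 'p padic) = - 1 / (padic_p - 1) * (padic_gamma_rat (G_arg TYPE('p) j) * padic_gamma_rat (G_arg TYPE('p) j)) *
     (G_factor q (G_arg TYPE('p) j) * G_factor (1 - q) (G_arg TYPE('p) j))"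

lemma G_term_reflect: "G_term (1 - q) j = G_term q j"
  by (simp add: G_term_def mult.commute)

lemma padic_G_eq: "(padic_G [q, 1 - q] :: 'p :: prime_card padic) = (\<Sum>j = 0..CARD('p) - 2. G_term q j)"
proof -
  have sq: "((- 1) ^ j * x) ^ 2 = x * x" for j and x :: "'p padic"
    by (simp add: power_mult_distrib power2_eq_square flip: power_add mult_2)
  have len: "length [q, 1 - q] = 2"
    by simp
  have pl: "prod_list (map f [q, 1 - q]) = f q * f (1 - q)" for f :: "rat \<Rightarrow> 'p padic"
    by simp
  show ?thesis
    unfolding padic_G_def Let_def sum_distrib_left
    by (intro sum.cong refl) (simp only: len sq pl G_term_def G_factor_def G_arg_def padic_p_def mult.assoc)
qed

lemma G_arg_bounds:
  assumes "j < CARD('p :: prime_card) - 1"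
  shows "0 \<le> G_arg TYPE('p) j" "G_arg TYPE('p) j < 1"
proof -
  have "of_nat j < (of_nat (CARD('p) - 1) :: rat)"
    using assms by (simp only: of_nat_less_iff)
  then have "of_nat j < (of_nat CARD('p) - 1 :: rat)"
    using assms by (simp add: of_nat_diff)
  moreover from this have "0 < (of_nat CARD('p) - 1 :: rat)"
    by (rule le_less_trans[rotated]) simp
  ultimately show "0 \<le> G_arg TYPE('p) j" "G_arg TYPE('p) j < 1"
    by (auto simp: G_arg_def)
qed

lemma padic_p_minus_1_unit [simp]: "padic_p - 1 \<in> padic_units"
proof -
  have "padic_p - 1 = - (1 + padic_p * (- 1))"
    by simp
  also have "\<dots> \<in> padic_units"
    by (intro padic_units_uminus padic_units_1_plus) simp
  finally show ?thesis .
qed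

text \<open>An exact form of \<open>1/(p - 1) = -1\<close> modulo \<open>p\<close>. It writes
  \<open>j/(p - 1)\<close> as an integer plus a multiple of \<open>p\<close>, as
  \<open>padic_gamma_slope\<close> demands.\<close>

lemma recip_p_minus_1:
  "1 / (padic_p - 1) = - 1 + (padic_p :: 'p :: prime_card padic) * (1 / (padic_p - 1))"
proof -
  define u :: "'p padic" where "u = padic_p - 1"
  have "u \<noteq> 0" "padic_p = u + 1"
    using padic_unitsD(2)[OF padic_p_minus_1_unit] by (auto simp: u_def)
  then show ?thesis
    unfolding u_def[symmetric] by (simp add: field_simps)
qed

lemma of_rat_G_arg:
  "of_rat (G_arg TYPE('p) j) = - of_nat j + (padic_p :: 'p :: prime_card padic) * (of_nat j * (1 / (padic_p - 1)))"
proof -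
  have "of_rat (G_arg TYPE('p) j) = of_nat j * (1 / (padic_p - 1 :: 'p padic))"
    by (simp add: G_arg_def of_rat_divide of_rat_diff padic_p_def)
  also have "\<dots> = of_nat j * (- 1 + padic_p * (1 / (padic_p - 1)))"
    by (rule arg_cong[OF recip_p_minus_1])
  finally show ?thesis
    by (simp add: algebra_simps)
qed

section \<open>Expansions of the terms of G for head, middle and tail indices\<close>

context
  fixes r :: nat and a g :: "'p :: prime_card padic" and q :: rat
  assumes r: "2 * r < CARD('p)" and a: "a \<in> \<int>\<^sub>p" and q: "of_rat q = - of_nat r + padic_p * a"
    and q01: "0 < q" "q < 1"
    and g: "padic_gamma_slope g"
begin

lemmas gpos = padic_gamma_slope_pos[OF g] and gneg = padic_gamma_slope_neg[OF g]

abbreviation "\<epsilon> \<equiv> 1 / (padic_p - 1) :: 'p padic"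

lemma \<epsilon>: "\<epsilon> \<in> \<int>\<^sub>p"
  by simp

lemma of_rat_left: "of_rat (q - G_arg TYPE('p) j) = of_nat j - of_nat r + padic_p * (a - of_nat j * \<epsilon>)"
  unfolding of_rat_diff of_rat_G_arg q by (simp add: right_diff_distrib)

lemma of_rat_right: "of_rat (1 - q - G_arg TYPE('p) j) = of_nat (Suc (r + j)) + padic_p * (- a - of_nat j * \<epsilon>)"
  unfolding of_rat_diff of_rat_G_arg q by (simp add: right_diff_distrib)

text \<open>The part shared by all floor cases; \<open>y1\<close> and \<open>y2\<close> stand for
  the gamma values in the numerators. The denominators have opposite slopes
  \<open>a (g + H_r)\<close> and \<open>-a (g + H_r)\<close>, which cancel, and their units multiply
  to \<open>(-1)^(r+1)\<close>.\<close>

lemma G_core_jet: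
  assumes j: "j < CARD('p)" and y1: "jet y1 u1 s1" and y2: "jet y2 u2 s2"
  shows "jet (- 1 / (padic_p - 1) * (padic_gamma_rat (G_arg TYPE('p) j) * padic_gamma_rat (G_arg TYPE('p) j)) *
     (y1 / padic_gamma_rat q * (y2 / padic_gamma_rat (1 - q))))
     ((- 1) ^ Suc r * (u1 * u2) / fact j ^ 2)
     (- \<epsilon> + 2 * of_nat j * \<epsilon> * (g + hsum j) + s1 + s2)"
proof -
  have "jet (1 + padic_p * (- \<epsilon>)) 1 (- \<epsilon> / 1)"
    using \<epsilon> by (intro jet_add) auto
  moreover have "1 + padic_p * (- \<epsilon>) = - (- 1 + padic_p * \<epsilon>)"
    by simp
  then have "1 + padic_p * (- \<epsilon>) = - 1 / (padic_p - 1)"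
    unfolding recip_p_minus_1[symmetric] by simp
  ultimately have e: "jet (- 1 / (padic_p - 1)) 1 (- \<epsilon>)"
    by simp
  have x: "jet (padic_gamma_rat (G_arg TYPE('p) j)) (1 / fact j) (of_nat j * \<epsilon> * (g + hsum j))"
    using \<epsilon> j by (intro gneg of_rat_G_arg) auto
  have q1: "jet (padic_gamma_rat q) (1 / fact r) (a * (g + hsum r))"
    using a r by (intro gneg q) auto
  have "of_rat (1 - q) = of_nat (Suc r) + padic_p * (- a)"
    by (simp add: of_rat_diff q)
  then have q2: "jet (padic_gamma_rat (1 - q)) ((- 1) ^ Suc r * fact r) (- a * (g + hsum r))"
    using a r by (intro gpos) auto
  have u: "1 * (1 / fact j * (1 / fact j)) * (u1 / (1 / fact r) * (u2 / ((- 1) ^ Suc r * fact r))) =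
      (- 1) ^ Suc r * (u1 * u2) / (fact j ^ 2 :: 'p padic)"
    by (cases "even r") (simp_all add: power2_eq_square)
  have s: "- \<epsilon> + (of_nat j * \<epsilon> * (g + hsum j) + of_nat j * \<epsilon> * (g + hsum j)) +
      (s1 - a * (g + hsum r) + (s2 - - a * (g + hsum r))) =
      - \<epsilon> + 2 * of_nat j * \<epsilon> * (g + hsum j) + s1 + s2"
    by (simp add: algebra_simps)
  from jet_mult[OF jet_mult[OF e jet_mult[OF x x]] jet_mult[OF jet_divide[OF y1 q1] jet_divide[OF y2 q2]]]
  show ?thesis
    unfolding u s .
qed

text \<open>Both floors are \<open>0\<close>, so no power of \<open>p\<close> occurs. In the total
  slope the coefficient of \<open>g\<close> is \<open>2 j \<epsilon> + (a - j \<epsilon>) + (- a - j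
  \<epsilon>) = 0\<close>. There remains \<open>-\<epsilon> X - Y\<close>, and
  \<open>\<epsilon>\<close> is congruent to \<open>-1\<close> modulo \<open>p\<close>.\<close>

lemma G_term_head:
  assumes j: "j \<le> r" and x: "G_arg TYPE('p) j \<le> q" "G_arg TYPE('p) j \<le> 1 - q"
  shows "jet (G_term q j :: 'p padic) (hyp_coeff r j)
    (1 + of_nat j * (hsum (r - j) + hsum (r + j) - 2 * hsum j) - a * (hsum (r + j) - hsum (r - j)))"
proof -
  let ?x = "G_arg TYPE('p) j"
  have "j < CARD('p) - 1"
    using j r prime_gt_1_nat[OF prime_card[where ?'a = 'p]] by linarith
  note b = G_arg_bounds[OF this]
  have y1: "jet (padic_gamma_rat (q - ?x)) (1 / fact (r - j)) ((a - of_nat j * \<epsilon>) * (g + hsum (r - j)))"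
    using of_rat_left[of j] j r a \<epsilon> by (intro gneg) (auto simp: of_nat_diff)
  have y2: "jet (padic_gamma_rat (1 - q - ?x)) ((- 1) ^ Suc (r + j) * fact (r + j)) ((- a - of_nat j * \<epsilon>) * (g + hsum (r + j)))"
    using j r a \<epsilon> by (intro gpos of_rat_right) auto
  have "(G_term q j :: 'p padic) = - 1 / (padic_p - 1) * (padic_gamma_rat ?x * padic_gamma_rat ?x) *
     (padic_gamma_rat (q - ?x) / padic_gamma_rat q * (padic_gamma_rat (1 - q - ?x) / padic_gamma_rat (1 - q)))"
    unfolding G_term_def using x q01 b by (simp add: G_factor_nonneg)
  moreover have "(- 1) ^ Suc r * (1 / fact (r - j) * ((- 1) ^ Suc (r + j) * fact (r + j))) / fact j ^ 2 = (hyp_coeff r j :: 'p padic)"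
    by (cases "even r"; cases "even j") (simp_all add: hyp_coeff_def)
  ultimately have *: "jet (G_term q j) (hyp_coeff r j) (- \<epsilon> + 2 * of_nat j * \<epsilon> * (g + hsum j) +
      (a - of_nat j * \<epsilon>) * (g + hsum (r - j)) + (- a - of_nat j * \<epsilon>) * (g + hsum (r + j)))"
    using G_core_jet[OF _ y1 y2, of j] j r by simp
  define X :: "'p padic" where "X = 1 + of_nat j * (hsum (r - j) + hsum (r + j) - 2 * hsum j)"
  define Y :: "'p padic" where "Y = a * (hsum (r + j) - hsum (r - j))"
  have eq: "- E + 2 * of_nat j * E * (g + hsum j) +
      (a - of_nat j * E) * (g + hsum (r - j)) + (- a - of_nat j * E) * (g + hsum (r + j)) = - E * X - Y" for E
    unfolding X_def Y_def by (simp add: algebra_simps)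
  have "X - Y - (- \<epsilon> * X - Y) = (\<epsilon> + 1) * X"
    by (simp add: algebra_simps)
  also have "\<epsilon> + 1 = padic_p * \<epsilon>"
    by (subst recip_p_minus_1) simp
  finally have "X - Y - (- \<epsilon> * X - Y) = padic_p * (\<epsilon> * X)"
    by (simp only: mult.assoc)
  moreover have "\<epsilon> * X \<in> \<int>\<^sub>p"
    unfolding X_def mult_2 using j r \<epsilon> by (intro Zp_mult Zp_add Zp_diff Zp_of_nat Zp_1 hsum_Zp) auto
  ultimately show ?thesis
    using * unfolding eq X_def[symmetric] Y_def[symmetric] by (rule_tac jet_slope_cong)
qed

text \<open>When exactly one floor is \<open>-1\<close>, the term is \<open>-p\<close> times a
  quotient that has to be known only modulo \<open>p\<close>.\<close>

lemma G_mid_aux: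
  assumes "(G_term q j :: 'p padic) = X * - padic_p" "jet X u s" "- u = v"
  shows "(G_term q j :: 'p padic) - padic_p * v \<in> padic_ideal 2"
proof -
  have "G_term q j - padic_p * v = padic_p * ((X - u) * (- 1))"
    unfolding assms(1) assms(3)[symmetric] by (simp add: algebra_simps)
  also have "\<dots> \<in> padic_ideal (Suc 1)"
    by (intro padic_p_mult_ideal padic_ideal_mult_Zp jet_diff_ideal_1[OF assms(2)]) auto
  finally show ?thesis
    by (simp add: numeral_2_eq_2)
qed

text \<open>The floor of \<open>q - x\<close> is \<open>-1\<close>, so the first numerator is taken
  near \<open>j - r + 1\<close> and gives \<open>(j - r)!\<close>. Splitting off
  \<open>(j - r - 1)!\<close>, as in the hypergeometric term, leaves the factor
  \<open>j - r\<close>.\<close>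

lemma G_term_mid_left:
  assumes j: "r < j" "j < CARD('p) - r" "j < CARD('p) - 1"
    and x: "q < G_arg TYPE('p) j" "G_arg TYPE('p) j \<le> 1 - q"
  shows "(G_term q j :: 'p padic) - padic_p * ((- 1) ^ r * of_nat (j - r) * (fact (j - Suc r) * fact (r + j) / fact j ^ 2)) \<in> padic_ideal 2"
proof -
  let ?x = "G_arg TYPE('p) j"
  note b = G_arg_bounds[OF j(3)]
  have "of_rat (q - ?x + 1) = of_nat (Suc (j - r)) + padic_p * (a - of_nat j * \<epsilon>)"
    unfolding of_rat_add of_rat_left using j by (simp add: of_nat_diff)
  then have y1: "jet (padic_gamma_rat (q - ?x + 1)) ((- 1) ^ Suc (j - r) * fact (j - r)) ((a - of_nat j * \<epsilon>) * (g + hsum (j - r)))"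
    using j a \<epsilon> by (intro gpos) auto
  have y2: "jet (padic_gamma_rat (1 - q - ?x)) ((- 1) ^ Suc (r + j) * fact (r + j)) ((- a - of_nat j * \<epsilon>) * (g + hsum (r + j)))"
    using j a \<epsilon> by (intro gpos of_rat_right) auto
  obtain k where k: "j = r + Suc k"
    using j(1) less_imp_Suc_add by auto
  show ?thesis
  proof (rule G_mid_aux[OF _ G_core_jet[OF _ y1 y2]])
    show "(G_term q j :: 'p padic) = - 1 / (padic_p - 1) * (padic_gamma_rat ?x * padic_gamma_rat ?x) *
       (padic_gamma_rat (q - ?x + 1) / padic_gamma_rat q * (padic_gamma_rat (1 - q - ?x) / padic_gamma_rat (1 - q))) * - padic_p"
      unfolding G_term_def using x q01 b by (simp add: G_factor_nonneg G_factor_neg)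
    show "- ((- 1) ^ Suc r * ((- 1) ^ Suc (j - r) * fact (j - r) * ((- 1) ^ Suc (r + j) * fact (r + j))) / fact j ^ 2) =
        (- 1) ^ r * of_nat (j - r) * (fact (j - Suc r) * fact (r + j) / fact j ^ 2 :: 'p padic)"
      unfolding k by (cases "even r"; cases "even k") (simp_all del: of_nat_Suc)
  qed (use j in auto)
qed

text \<open>The floor of \<open>1 - q - x\<close> is \<open>-1\<close>; the shift by
  \<open>1\<close> turns \<open>(r + j)!\<close> into \<open>(r + j + 1)!\<close> and so yields the
  factor \<open>r + j + 1\<close>. The bound \<open>j < p - 1 - r\<close> keeps
  \<open>r + j + 1\<close> below \<open>p\<close>, where the gamma expansion is available.\<close>

lemma G_term_mid_right:
  assumes j: "r < j" "j < CARD('p) - 1 - r" "j < CARD('p) - 1"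
    and x: "1 - q < G_arg TYPE('p) j" "G_arg TYPE('p) j \<le> q"
  shows "(G_term q j :: 'p padic) - padic_p * ((- 1) ^ r * of_nat (Suc (r + j)) * (fact (j - Suc r) * fact (r + j) / fact j ^ 2)) \<in> padic_ideal 2"
proof -
  let ?x = "G_arg TYPE('p) j"
  note b = G_arg_bounds[OF j(3)]
  obtain k where k: "j = r + Suc k"
    using j(1) less_imp_Suc_add by auto
  have "of_rat (1 - q - ?x + 1) = of_nat (Suc (Suc (r + j))) + padic_p * (- a - of_nat j * \<epsilon>)"
    unfolding of_rat_add of_rat_right by simp
  then have y2: "jet (padic_gamma_rat (1 - q - ?x + 1)) ((- 1) ^ Suc (Suc (r + j)) * fact (Suc (r + j))) ((- a - of_nat j * \<epsilon>) * (g + hsum (Suc (r + j))))"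
    using j a \<epsilon> by (intro gpos) auto
  have "of_rat (q - ?x) = of_nat (Suc k) + padic_p * (a - of_nat j * \<epsilon>)"
    unfolding of_rat_left by (simp add: k)
  then have y1: "jet (padic_gamma_rat (q - ?x)) ((- 1) ^ Suc k * fact k) ((a - of_nat j * \<epsilon>) * (g + hsum k))"
    using j a \<epsilon> k by (intro gpos) auto
  show ?thesis
  proof (rule G_mid_aux[OF _ G_core_jet[OF _ y1 y2]])
    show "(G_term q j :: 'p padic) = - 1 / (padic_p - 1) * (padic_gamma_rat ?x * padic_gamma_rat ?x) *
       (padic_gamma_rat (q - ?x) / padic_gamma_rat q * (padic_gamma_rat (1 - q - ?x + 1) / padic_gamma_rat (1 - q))) * - padic_p"
      unfolding G_term_def using x q01 b by (simp add: G_factor_nonneg G_factor_neg)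
    have sgn: "(- 1) ^ Suc r * ((- 1) ^ Suc k * X * ((- 1) ^ Suc (Suc (r + j)) * Y)) = - ((- 1) ^ r * (X * Y))" for X Y :: "'p padic"
      unfolding k by (cases "even r"; cases "even k") simp_all
    have jk: "j - Suc r = k"
      using k by simp
    show "- ((- 1) ^ Suc r * ((- 1) ^ Suc k * fact k * ((- 1) ^ Suc (Suc (r + j)) * fact (Suc (r + j)))) / fact j ^ 2) =
        (- 1) ^ r * of_nat (Suc (r + j)) * (fact (j - Suc r) * fact (r + j) / fact j ^ 2 :: 'p padic)"
      unfolding sgn jk fact_Suc[of "r + j"] by (simp add: ac_simps del: of_nat_Suc)
  qed (use j in auto)
qed

lemma G_term_tail:
  assumes j: "j < CARD('p) - 1" and x: "q < G_arg TYPE('p) j" "1 - q < G_arg TYPE('p) j"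
  shows "(G_term q j :: 'p padic) \<in> padic_ideal 2"
proof -
  let ?x = "G_arg TYPE('p) j"
  note b = G_arg_bounds[OF j]
  have q1: "padic_gamma_rat q \<in> (padic_units :: 'p padic set)"
    using a r by (intro jet_unit[OF gneg[OF q]]) auto
  have "of_rat (1 - q) = of_nat (Suc r) + padic_p * (- a)"
    by (simp add: of_rat_diff q)
  from jet_unit[OF gpos[OF this]] have q2: "padic_gamma_rat (1 - q) \<in> (padic_units :: 'p padic set)"
    using a r by auto
  have G: "(G_term q j :: 'p padic) = padic_p ^ 2 * (- 1 / (padic_p - 1) * (padic_gamma_rat ?x * padic_gamma_rat ?x) *
       (padic_gamma_rat (q - ?x + 1) / padic_gamma_rat q * (padic_gamma_rat (1 - q - ?x + 1) / padic_gamma_rat (1 - q))))"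
    unfolding G_term_def using x q01 b by (simp add: G_factor_neg power2_eq_square ac_simps)
  have Z: "padic_gamma_rat t \<in> \<int>\<^sub>p" for t
    by (simp add: padic_gamma_rat_def)
  show ?thesis
    using q1 q2 padic_p_minus_1_unit[where ?'a = 'p] by (intro padic_idealI[OF G] Zp_mult Zp_divide Z) auto
qed

end

section \<open>The congruence\<close>

text \<open>Here \<open>q\<close> is whichever of \<open>Q\<close> and \<open>1 - Q\<close> is
  congruent to \<open>-r\<close>; both sides are symmetric under exchanging them. The hypotheses
  locate \<open>j/(p - 1)\<close> relative to \<open>q\<close> and \<open>1 - q\<close>. The factor
  \<open>\<kappa>\<close> is only required to be congruent to \<open>a + j\<close>, since the two
  residue classes of \<open>p\<close> produce different expressions for it.\<close>

lemma padic_G_congruence: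
  fixes a g :: "'p :: prime_card padic"
  assumes odd: "odd CARD('p)"
    and r: "2 * r < CARD('p)" and a: "a \<in> \<int>\<^sub>p" and q: "of_rat q = - of_nat r + padic_p * a"
    and q01: "0 < q" "q < 1"
    and g: "padic_gamma_slope g"
    and head: "\<And>j. j \<le> r \<Longrightarrow> G_arg TYPE('p) j \<le> q \<and> G_arg TYPE('p) j \<le> 1 - q"
    and mid: "\<And>j. r < j \<Longrightarrow> j < CARD('p) - r \<Longrightarrow> \<exists>\<kappa>. \<kappa> - a - of_nat j \<in> padic_ideal 1 \<and>
      (if j < CARD('p) - 1 then G_term q j else 0) -
        padic_p * ((- 1) ^ r * \<kappa> * (fact (j - Suc r) * fact (r + j) / fact j ^ 2)) \<in> padic_ideal 2"
    and tail: "\<And>j. CARD('p) - r \<le> j \<Longrightarrow> j < CARD('p) - 1 \<Longrightarrow> q < G_arg TYPE('p) j \<and> 1 - q < G_arg TYPE('p) j"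
    and Q: "Q = q \<or> Q = 1 - q"
  shows "padic_cong (padic_G [Q, 1 - Q] :: 'p padic)
    (of_rat (truncated_hypergeometric [Q, 1 - Q] [1] 1 (CARD('p) - 1))) (CARD('p)\<^sup>2)"
proof -
  let ?p = "CARD('p)"
  define b :: "'p padic" where "b = of_rat q"
  have b: "b = - of_nat r + padic_p * a"
    by (simp add: b_def q)
  \<comment> \<open>The sum for G ends at \<open>p - 2\<close> and the hypergeometric one at
    \<open>p - 1\<close>; the missing term is filled with \<open>0\<close>.\<close>
  define f where "f = (\<lambda>j. if j < ?p - 1 then G_term q j else 0 :: 'p padic)"
  obtain \<kappa> where \<kappa>: "\<And>j. r < j \<Longrightarrow> j < ?p - r \<Longrightarrow> \<kappa> j - a - of_nat j \<in> padic_ideal 1"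
    "\<And>j. r < j \<Longrightarrow> j < ?p - r \<Longrightarrow>
      f j - padic_p * ((- 1) ^ r * \<kappa> j * (fact (j - Suc r) * fact (r + j) / fact j ^ 2)) \<in> padic_ideal 2"
    using mid unfolding f_def by metis
  have p1: "?p > 1"
    by (rule prime_gt_1_nat[OF prime_card])
  have "(\<Sum>j = 0..?p - 1. f j) - (\<Sum>j = 0..?p - 1. hyp_term b j) \<in> padic_ideal 2"
  proof (rule hyp_term_sums_congruence[OF odd r a b _ \<kappa>(2,1)])
    fix j assume j: "j \<le> r"
    then have "j < ?p - 1"
      using r p1 by linarith
    then show "jet (f j) (hyp_coeff r j)
      (1 + of_nat j * (hsum (r - j) + hsum (r + j) - 2 * hsum j) - a * (hsum (r + j) - hsum (r - j)))"
      using G_term_head[OF r a q q01 g j] head[OF j] by (simp add: f_def)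
  next
    fix j assume "?p - r \<le> j"
    then show "f j \<in> padic_ideal 2"
      using G_term_tail[OF r a q q01 g, of j] tail[of j] by (simp add: f_def)
  qed
  then obtain z where z: "z \<in> \<int>\<^sub>p" "(\<Sum>j = 0..?p - 1. f j) - (\<Sum>j = 0..?p - 1. hyp_term b j) = padic_p ^ 2 * z"
    by (rule padic_idealE)
  have GQ: "G_term Q j = (G_term q j :: 'p padic)" and FQ: "hyp_term (of_rat Q) j = hyp_term b j" for j
    using Q by (auto simp: G_term_reflect hyp_term_reflect b_def of_rat_diff)
  have "{0..?p - 1} = insert (?p - 1) {0..?p - 2}"
    using p1 by auto
  then have "(\<Sum>j = 0..?p - 1. f j) = (\<Sum>j = 0..?p - 2. f j)"
    using p1 by (simp add: f_def)
  also have "\<dots> = padic_G [Q, 1 - Q]"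
    unfolding padic_G_eq GQ using p1 by (intro sum.cong) (auto simp: f_def)
  finally have G: "padic_G [Q, 1 - Q] = (\<Sum>j = 0..?p - 1. hyp_term b j) + padic_p ^ 2 * z"
    using z(2) by (simp add: algebra_simps)
  have F: "of_rat (truncated_hypergeometric [Q, 1 - Q] [1] 1 (?p - 1)) = (\<Sum>j = 0..?p - 1. hyp_term b j)"
    unfolding of_rat_truncated_hypergeometric FQ ..
  have Fz: "(\<Sum>j = 0..?p - 1. hyp_term b j) \<in> \<int>\<^sub>p"
    using p1 by (intro Zp_sum hyp_term_Zp[OF r a b]) auto
  have "of_nat (?p\<^sup>2) = (padic_p ^ 2 :: 'p padic)"
    by (simp add: padic_p_def)
  then show ?thesis
    unfolding padic_cong_def F G using Fz z(1) by (auto intro!: bexI[of _ z])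
qed

lemma G_arg_le_divide_iff:
  fixes n :: int
  assumes "m > 0"
  shows "G_arg TYPE('p :: prime_card) j \<le> of_int n / of_int m \<longleftrightarrow> int j * m \<le> n * (int CARD('p) - 1)"
proof -
  have "int CARD('p) - 1 > 0"
    using padic_card_gt_1[where ?'p = 'p] by simp
  then have "(of_int (int CARD('p) - 1) :: rat) > 0" "(of_int m :: rat) > 0"
    using assms by (simp_all only: of_int_0_less_iff)
  moreover have "G_arg TYPE('p) j = of_int (int j) / of_int (int CARD('p) - 1)"
    by (simp add: G_arg_def)
  ultimately have "G_arg TYPE('p) j \<le> of_int n / of_int m \<longleftrightarrow>
      (of_int (int j) * of_int m :: rat) \<le> of_int n * of_int (int CARD('p) - 1)"
    by (simp only: divide_le_eq pos_le_divide_eq times_divide_eq_left mult.commute if_True)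
  then show ?thesis
    by (simp only: of_int_mult[symmetric] of_int_le_iff)
qed

text \<open>From \<open>p = d r + 1\<close> follows \<open>1/d = -r + p/d\<close>, so
  \<open>q\<close> and \<open>a\<close> are both \<open>1/d\<close>. The floors change just after
  \<open>j = r\<close> and at \<open>j = p - r\<close>, exactly where the p-adic order of the
  hypergeometric terms is split.\<close>

lemma padic_G_congruence_pos:
  fixes d r :: nat
  assumes odd: "odd CARD('p :: prime_card)" and d: "d \<ge> 2" and dr: "CARD('p) = d * r + 1"
  shows "padic_cong
    (padic_G [1 / of_nat d, 1 - 1 / of_nat d] :: 'p padic)
    (of_rat (truncated_hypergeometric [1 / of_nat d, 1 - 1 / of_nat d] [1] 1 (CARD('p) - 1)))
    (CARD('p)\<^sup>2)"
proof -
  let ?p = "CARD('p)"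
  obtain g :: "'p padic" where g: "padic_gamma_slope g"
    using padic_gamma_slope_exists[OF odd] by blast
  have p1: "?p > 1"
    by (rule prime_gt_1_nat[OF prime_card])
  have r0: "r > 0"
    using dr p1 by (cases r) auto
  have "2 * r \<le> d * r"
    using d by (rule mult_right_mono) simp
  then have r: "2 * r < ?p"
    using dr by linarith
  define a :: "'p padic" where "a = 1 / of_nat d"
  define q :: rat where "q = 1 / of_nat d"
  have "\<not> ?p dvd d"
  proof
    assume "?p dvd d"
    then have "?p dvd d * r"
      by (rule dvd_mult2)
    then have "?p dvd 1"
      using dr by (metis dvd_add_right_iff dvd_refl)
    then show False
      using p1 by simp
  qed
  then have a: "a \<in> \<int>\<^sub>p"
    unfolding a_def by (intro Zp_divide padic_units_of_nat) auto
  have "padic_p = (of_nat d * of_nat r + 1 :: 'p padic)"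
    unfolding padic_p_def dr by simp
  then have ar: "a = - of_nat r + padic_p * a"
    using d by (simp add: a_def field_simps)
  have qa: "of_rat q = a"
    by (simp add: q_def a_def of_rat_divide)
  have q01: "0 < q" "q < 1"
    using d by (simp_all add: q_def)
  define m where "m = int ?p - 1"
  have m: "m > 0" "m = int d * int r"
    using p1 dr by (auto simp: m_def)
  have q1: "q = of_int (int r) / of_int m"
    using d r0 by (simp add: q_def m(2))
  have q2: "1 - q = of_int (m - int r) / of_int m"
    unfolding q1 using m(1) by (simp add: diff_divide_distrib)
  have le1: "G_arg TYPE('p) j \<le> q \<longleftrightarrow> j \<le> r" for j
    unfolding q1 G_arg_le_divide_iff[OF m(1)] m_def[symmetric] using m(1) by simp
  have le2: "G_arg TYPE('p) j \<le> 1 - q \<longleftrightarrow> j < ?p - r" for j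
    unfolding q2 G_arg_le_divide_iff[OF m(1)] m_def[symmetric] using m(1) by (simp add: m_def) linarith
  have "padic_cong (padic_G [q, 1 - q] :: 'p padic)
    (of_rat (truncated_hypergeometric [q, 1 - q] [1] 1 (?p - 1))) (?p\<^sup>2)"
  proof (rule padic_G_congruence[OF odd r a _ q01 g])
    show q': "of_rat q = - of_nat r + padic_p * a"
      using qa ar by simp
    show "G_arg TYPE('p) j \<le> q \<and> G_arg TYPE('p) j \<le> 1 - q" if "j \<le> r" for j
      unfolding le1 le2 using that r by linarith
    show "q < G_arg TYPE('p) j \<and> 1 - q < G_arg TYPE('p) j" if "?p - r \<le> j" for j
      unfolding not_le[symmetric] le1 le2 using that r by linarith
    show "\<exists>\<kappa>. \<kappa> - a - of_nat j \<in> padic_ideal 1 \<and>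
      (if j < ?p - 1 then G_term q j else 0) -
        padic_p * ((- 1) ^ r * \<kappa> * (fact (j - Suc r) * fact (r + j) / fact j ^ 2)) \<in> padic_ideal 2"
      if j: "r < j" "j < ?p - r" for j
    proof (intro exI conjI)
      \<comment> \<open>The witness \<open>j - r\<close> comes from \<open>G_term_mid_left\<close>;
        because \<open>a = -r + p a\<close>, it differs from \<open>a + j\<close> by
        \<open>-p a\<close>.\<close>
      have "of_nat (j - r) - a - of_nat j = padic_p ^ 1 * (- a)"
        using j by (subst (1) ar) (simp add: of_nat_diff)
      then show "of_nat (j - r) - a - of_nat j \<in> padic_ideal 1"
        by (rule padic_idealI) (use a in simp)
      have j1: "j < ?p - 1"
        using j r0 by linarith
      have x: "q < G_arg TYPE('p) j" "G_arg TYPE('p) j \<le> 1 - q"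
        using j le1[of j] le2[of j] by auto
      show "(if j < ?p - 1 then G_term q j else 0) -
        padic_p * ((- 1) ^ r * of_nat (j - r) * (fact (j - Suc r) * fact (r + j) / fact j ^ 2)) \<in> (padic_ideal 2 :: 'p padic set)"
        using G_term_mid_left[OF r a q' q01 g j j1 x] j1 by simp
    qed
  qed simp_all
  then show ?thesis
    by (simp add: q_def)
qed

text \<open>From \<open>p + 1 = d (r + 1)\<close> follows \<open>1 - 1/d = -r + p/d\<close>, so the
  two arguments exchange roles: \<open>q = 1 - 1/d\<close> while \<open>a = 1/d\<close>. The second
  change of floor now occurs at \<open>j = p - 1 - r\<close>, one index before the tail, and this
  index is treated separately. The bound \<open>d >= 3\<close> gives
  \<open>2r + 1 < p\<close>.\<close>

lemma padic_G_congruence_neg: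
  fixes d r :: nat
  assumes odd: "odd CARD('p :: prime_card)" and d: "d \<ge> 3" and dr: "CARD('p) + 1 = d * (r + 1)"
  shows "padic_cong
    (padic_G [1 / of_nat d, 1 - 1 / of_nat d] :: 'p padic)
    (of_rat (truncated_hypergeometric [1 / of_nat d, 1 - 1 / of_nat d] [1] 1 (CARD('p) - 1)))
    (CARD('p)\<^sup>2)"
proof -
  let ?p = "CARD('p)"
  obtain g :: "'p padic" where g: "padic_gamma_slope g"
    using padic_gamma_slope_exists[OF odd] by blast
  have p1: "?p > 1"
    by (rule prime_gt_1_nat[OF prime_card])
  have "3 * (r + 1) \<le> d * (r + 1)"
    using d by (rule mult_right_mono) simp
  then have "3 * (r + 1) \<le> ?p + 1"
    by (simp only: dr)
  then have r2: "2 * r + 1 < ?p" and r: "2 * r < ?p"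
    by simp_all
  define a :: "'p padic" where "a = 1 / of_nat d"
  define q :: rat where "q = 1 - 1 / of_nat d"
  have "\<not> ?p dvd d"
  proof
    assume "?p dvd d"
    then have "?p dvd d * (r + 1)"
      by (rule dvd_mult2)
    then have "?p dvd 1"
      using dr by (metis dvd_add_right_iff dvd_refl)
    then show False
      using p1 by simp
  qed
  then have a: "a \<in> \<int>\<^sub>p"
    unfolding a_def by (intro Zp_divide padic_units_of_nat) auto
  have "padic_p + 1 = (of_nat d * (of_nat r + 1) :: 'p padic)"
    using arg_cong[OF dr, of "of_nat :: nat \<Rightarrow> 'p padic"] by (simp add: padic_p_def algebra_simps)
  then have "(padic_p + 1) * a = of_nat d * (of_nat r + 1) * a"
    by simp
  also have "\<dots> = of_nat r + 1"
    using d by (simp add: a_def)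
  finally have ar: "padic_p * a = of_nat r + 1 - a"
    by (simp add: algebra_simps)
  have q': "of_rat q = - of_nat r + padic_p * a"
    unfolding ar by (simp add: q_def a_def of_rat_divide of_rat_diff)
  have q01: "0 < q" "q < 1"
    using d by (simp_all add: q_def)
  define m where "m = int ?p + 1"
  have "m = int (d * (r + 1))"
    unfolding m_def dr[symmetric] by simp
  then have m: "m > 0" "m = int d * (int r + 1)"
    by (auto simp: m_def algebra_simps)
  have q2: "1 - q = of_int (int r + 1) / of_int m"
    using d by (simp add: q_def m(2))
  then have "q = 1 - of_int (int r + 1) / of_int m"
    by simp
  then have q1: "q = of_int (m - (int r + 1)) / of_int m"
    using m(1) by (simp add: diff_divide_distrib)
  have le1: "G_arg TYPE('p) j \<le> q \<longleftrightarrow> j < ?p - 1 - r" for j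
  proof -
    have *: "G_arg TYPE('p) j \<le> q \<longleftrightarrow> int j * (int ?p + 1) \<le> (int ?p - int r) * (int ?p - 1)"
      unfolding q1 G_arg_le_divide_iff[OF m(1)] by (simp add: m_def)
    show ?thesis
    proof (cases "j < ?p - 1 - r")
      case True
      then have "int j * (int ?p + 1) \<le> (int ?p - 2 - int r) * (int ?p + 1)"
        by (intro mult_right_mono) auto
      also have "\<dots> = (int ?p - int r) * (int ?p - 1) - 2 * int r - 2"
        by (simp add: algebra_simps)
      finally show ?thesis
        unfolding * using True by linarith
    next
      case False
      then have "(int ?p - 1 - int r) * (int ?p + 1) \<le> int j * (int ?p + 1)"
        using r by (intro mult_right_mono) auto
      moreover have "(int ?p - 1 - int r) * (int ?p + 1) = (int ?p - int r) * (int ?p - 1) + (int ?p - 2 * int r - 1)"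
        by (simp add: algebra_simps)
      ultimately show ?thesis
        unfolding * using False r2 by linarith
    qed
  qed
  have le2: "G_arg TYPE('p) j \<le> 1 - q \<longleftrightarrow> j \<le> r" for j
  proof -
    have *: "G_arg TYPE('p) j \<le> 1 - q \<longleftrightarrow> int j * (int ?p + 1) \<le> (int r + 1) * (int ?p - 1)"
      unfolding q2 G_arg_le_divide_iff[OF m(1)] by (simp add: m_def)
    show ?thesis
    proof (cases "j \<le> r")
      case True
      then have "int j * (int ?p + 1) \<le> int r * (int ?p + 1)"
        by (intro mult_right_mono) auto
      also have "\<dots> = (int r + 1) * (int ?p - 1) - (int ?p - 1 - 2 * int r)"
        by (simp add: algebra_simps)
      finally show ?thesis
        unfolding * using True r2 by linarith
    next
      case False
      then have "(int r + 1) * (int ?p + 1) \<le> int j * (int ?p + 1)"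
        by (intro mult_right_mono) auto
      moreover have "(int r + 1) * (int ?p + 1) = (int r + 1) * (int ?p - 1) + 2 * int r + 2"
        by (simp add: algebra_simps)
      ultimately show ?thesis
        unfolding * using False by linarith
    qed
  qed
  show ?thesis
  proof (rule padic_G_congruence[OF odd r a q' q01 g])
    show "G_arg TYPE('p) j \<le> q \<and> G_arg TYPE('p) j \<le> 1 - q" if "j \<le> r" for j
      unfolding le1 le2 using that r2 by linarith
    show "q < G_arg TYPE('p) j \<and> 1 - q < G_arg TYPE('p) j" if "?p - r \<le> j" for j
      unfolding not_le[symmetric] le1 le2 using that r2 by linarith
    show "1 / of_nat d = q \<or> 1 / of_nat d = 1 - q"
      by (simp add: q_def)
    show "\<exists>\<kappa>. \<kappa> - a - of_nat j \<in> padic_ideal 1 \<and>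
      (if j < ?p - 1 then G_term q j else 0) -
        padic_p * ((- 1) ^ r * \<kappa> * (fact (j - Suc r) * fact (r + j) / fact j ^ 2)) \<in> padic_ideal 2"
      if j: "r < j" "j < ?p - r" for j
    proof (intro exI conjI)
      \<comment> \<open>The witness \<open>r + j + 1\<close> comes from
        \<open>G_term_mid_right\<close>; it differs from \<open>a + j\<close> by
        \<open>r + 1 - a = p a\<close>.\<close>
      have "of_nat (Suc (r + j)) - a - of_nat j = padic_p ^ 1 * a"
        unfolding power_one_right ar by simp
      then show "of_nat (Suc (r + j)) - a - of_nat j \<in> padic_ideal 1"
        by (rule padic_idealI) (rule a)
      let ?M = "fact (j - Suc r) * fact (r + j) / fact j ^ 2 :: 'p padic"
      show "(if j < ?p - 1 then G_term q j else 0) - padic_p * ((- 1) ^ r * of_nat (Suc (r + j)) * ?M) \<in> padic_ideal 2"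
      proof (cases "j < ?p - 1 - r")
        case True
        then have j1: "j < ?p - 1"
          by linarith
        have x: "1 - q < G_arg TYPE('p) j" "G_arg TYPE('p) j \<le> q"
          using True j le1[of j] le2[of j] by auto
        show ?thesis
          using G_term_mid_right[OF r a q' q01 g j(1) True j1 x] j1 by simp
      next
        case False
        \<comment> \<open>The boundary index \<open>j = p - 1 - r\<close>: both floors are already
          \<open>-1\<close>, or \<open>r = 0\<close> and the term is the \<open>0\<close> filled in
          at \<open>p - 1\<close>. The witness \<open>r + j + 1\<close> equals \<open>p\<close>
          here, so the comparison term is also divisible by \<open>p^2\<close>.\<close>
        then have jp: "Suc (r + j) = ?p"
          using j by linarith
        have "q < G_arg TYPE('p) j" "1 - q < G_arg TYPE('p) j"
          using False j le1[of j] le2[of j] by auto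
        then have "(if j < ?p - 1 then G_term q j else 0) \<in> (padic_ideal 2 :: 'p padic set)"
          using G_term_tail[OF r a q' q01 g, of j] by simp
        moreover have "padic_p * ((- 1) ^ r * of_nat (Suc (r + j)) * ?M) = padic_p ^ 2 * ((- 1) ^ r * ?M)"
          unfolding jp padic_p_def by (simp add: power2_eq_square)
        then have "padic_p * ((- 1) ^ r * of_nat (Suc (r + j)) * ?M) \<in> padic_ideal 2"
          by (rule padic_idealI) (use j in \<open>intro Zp_mult Zp_divide padic_units_power padic_units_fact; simp\<close>)
        ultimately show ?thesis
          by (rule padic_ideal_diff)
      qed
    qed
  qed
qed

theorem theorem2p4:
  fixes d p :: nat
  assumes "d \<ge> 2"
    and "p = CARD('p :: prime_card)" and "prime p" and "odd p"
    and "[int p = 1] (mod int d) \<or> [int p = - 1] (mod int d)"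
  shows "padic_cong
    (padic_G [1 / of_nat d, 1 - 1 / of_nat d] :: 'p padic)
    (of_rat (truncated_hypergeometric [1 / of_nat d, 1 - 1 / of_nat d] [1] 1 (p - 1)))
    (p\<^sup>2)"
proof -
  have p1: "p > 1"
    using assms(3) by (rule prime_gt_1_nat)
  \<comment> \<open>For \<open>d = 2\<close> the two congruences on an odd \<open>p\<close>
    coincide; this case is assigned to \<open>p - 1\<close>, which leaves \<open>d >= 3\<close> for
    the other.\<close>
  consider "d dvd p - 1" | "d \<ge> 3" "d dvd p + 1"
  proof (cases "[int p = 1] (mod int d) \<or> d = 2")
    case True
    then have "int d dvd int p - 1"
      using assms(4) by (auto simp: cong_iff_dvd_diff)
    then have "d dvd p - 1"
      using p1 by (metis of_nat_1 of_nat_diff of_nat_dvd_iff less_imp_le)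
    then show ?thesis
      by (rule that)
  next
    case False
    then have "int d dvd int (p + 1)"
      using assms(5) by (simp add: cong_iff_dvd_diff add.commute)
    then have "d dvd p + 1"
      by (simp only: of_nat_dvd_iff)
    then show ?thesis
      using that(2) False assms(1) by simp
  qed
  then show ?thesis
  proof cases
    case 1
    then obtain r where "p - 1 = d * r"
      by (auto simp: dvd_def)
    then have "CARD('p) = d * r + 1"
      using p1 assms(2) by simp
    from padic_G_congruence_pos[OF _ assms(1) this] assms(2,4) show ?thesis
      by simp
  next
    case 2
    then obtain s where s: "p + 1 = d * s"
      by (auto simp: dvd_def)
    then obtain r where "s = r + 1"
      by (cases s) auto
    then have "CARD('p) + 1 = d * (r + 1)"
      using s assms(2) by simp
    from padic_G_congruence_neg[OF _ 2(1) this] assms(2,4) show ?thesis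
      by simp
  qed
qed

end
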